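(* Let $A_1,\ldots,A_k\in\mathcal{M}_q$ be positive matrices and let $\Phi:\mathcal{M}_q^k\to\mathcal{M}_p$ be a unital positive multilinear mapping. If $f:[0,\infty)\to\mathbb{R}$ is a sub-multiplicative matrix convex function, then $$f(\Phi(A_1,\ldots,A_k))\leq \Phi(f(A_1),\ldots,f(A_k)).$$ If $f:[0,\infty)\to\mathbb{R}$ is a super-multiplicative matrix concave function, then $$f(\Phi(A_1,\ldots,A_k))\geq \Phi(f(A_1),\ldots,f(A_k)).$$
   Context: $\mathcal{M}_p$ is the algebra of $p\times p$ complex matrices with identity $I$. A matrix $A$ is positive ($A\geq0$) if it is Hermitian with all eigenvalues nonnegative, and strictly positive ($A>0$) if moreover invertible; $A\leq B$ means $B-A\geq 0$. A map $\Phi:\mathcal{M}_q^k\to\mathcal{M}_p$ is multilinear if it is linear in each of its variables; positive if $\Phi(A_1,\ldots,A_k)\geq 0$ whenever all $A_i\geq0$; unital if $\Phi(I,\ldots,I)=I$. For Hermitian $A$, $f(A)$ is defined by functional calculus. A continuous function $f:J\to\mathbb{R}$ on an interval $J$ is matrix convex if $f\left(\frac{A+B}{2}\right)\leq\frac{f(A)+f(B)}{2}$ for all Hermitian matrices $A,B$ (of the same, arbitrary size) with eigenvalues in $J$; it is matrix concave if $-f$ is matrix convex. A real continuous function $f$ is sub-multiplicative on $J$ if $f(xy)\leq f(x)f(y)$ for all $x,y\in J$, and super-multiplicative on $J$ if $f(xy)\geq f(x)f(y)$ for all $x,y\in J$.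
   Formalization: For odd k ≥ 3 the first inequality is stated only for f ≥ 0 on [0,∞); without this it is false: for k=3, p=q=1, Φ(a,b,c)=abc, the constant f=-2 is sub-multiplicative and matrix convex, but -2 ≤ -8 fails. For k=1 and even k, and in the second part, nothing is added. *)

theory Defs
  imports Complex_Main "Jordan_Normal_Form.Spectral_Radius"
begin

definition hermitian_mat :: "nat \<Rightarrow> complex mat \<Rightarrow> bool" where
  "hermitian_mat n A \<longleftrightarrow> A \<in> carrier_mat n n \<and> mat_adjoint A = A"

definition positive_mat :: "nat \<Rightarrow> complex mat \<Rightarrow> bool" where
  "positive_mat n A \<longleftrightarrow>
     hermitian_mat n A \<and> (\<forall>e. eigenvalue A e \<longrightarrow> e \<in> \<real> \<and> 0 \<le> Re e)"

definition loewner_le :: "nat \<Rightarrow> complex mat \<Rightarrow> complex mat \<Rightarrow> bool" where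
  "loewner_le n A B \<longleftrightarrow>
     A \<in> carrier_mat n n \<and> B \<in> carrier_mat n n \<and> positive_mat n (B - A)"

definition unitary_mat :: "nat \<Rightarrow> complex mat \<Rightarrow> bool" where
  "unitary_mat n U \<longleftrightarrow>
     U \<in> carrier_mat n n \<and> mat_adjoint U * U = 1\<^sub>m n \<and> U * mat_adjoint U = 1\<^sub>m n"

(* Functional calculus: if A = U diag(d) U* with U unitary and d real, then
   f(A) = U diag(f o d) U*.  For Hermitian A such a decomposition exists by the
   spectral theorem, and the result does not depend on its choice: W = V* U with
   diag(e) W = W diag(d) gives diag(f o e) W = W diag(f o d) entrywise.
   Only meant for Hermitian A; only the values of f on the spectrum matter. *)
definition mat_fun :: "(real \<Rightarrow> real) \<Rightarrow> complex mat \<Rightarrow> complex mat" where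
  "mat_fun f A = (THE B. \<exists>U d. unitary_mat (dim_row A) U \<and>
     A = U * mat_diag (dim_row A) (\<lambda>i. complex_of_real (d i)) * mat_adjoint U \<and>
     B = U * mat_diag (dim_row A) (\<lambda>i. complex_of_real (f (d i))) * mat_adjoint U)"

definition matrix_convex_on :: "real set \<Rightarrow> (real \<Rightarrow> real) \<Rightarrow> bool" where
  "matrix_convex_on J f \<longleftrightarrow> continuous_on J f \<and>
     (\<forall>n A B. hermitian_mat n A \<and> spectrum A \<subseteq> complex_of_real ` J \<and>
              hermitian_mat n B \<and> spectrum B \<subseteq> complex_of_real ` J \<longrightarrow>
        loewner_le n (mat_fun f ((1/2) \<cdot>\<^sub>m (A + B))) ((1/2) \<cdot>\<^sub>m (mat_fun f A + mat_fun f B)))"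

definition matrix_concave_on :: "real set \<Rightarrow> (real \<Rightarrow> real) \<Rightarrow> bool" where
  "matrix_concave_on J f \<longleftrightarrow> matrix_convex_on J (\<lambda>x. - f x)"

definition sub_multiplicative_on :: "real set \<Rightarrow> (real \<Rightarrow> real) \<Rightarrow> bool" where
  "sub_multiplicative_on J f \<longleftrightarrow>
     continuous_on J f \<and> (\<forall>x\<in>J. \<forall>y\<in>J. f (x * y) \<le> f x * f y)"

definition super_multiplicative_on :: "real set \<Rightarrow> (real \<Rightarrow> real) \<Rightarrow> bool" where
  "super_multiplicative_on J f \<longleftrightarrow>
     continuous_on J f \<and> (\<forall>x\<in>J. \<forall>y\<in>J. f (x * y) \<ge> f x * f y)"

(* A k-tuple of q x q matrices is a list of length k; the behaviour of a map on
   any other list is irrelevant. *)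
definition mat_tuples :: "nat \<Rightarrow> nat \<Rightarrow> complex mat list set" where
  "mat_tuples k q = {As. length As = k \<and> set As \<subseteq> carrier_mat q q}"

definition multilinear_map ::
    "nat \<Rightarrow> nat \<Rightarrow> nat \<Rightarrow> (complex mat list \<Rightarrow> complex mat) \<Rightarrow> bool" where
  "multilinear_map k q p \<Phi> \<longleftrightarrow>
     (\<forall>As \<in> mat_tuples k q. \<Phi> As \<in> carrier_mat p p) \<and>
     (\<forall>As \<in> mat_tuples k q. \<forall>i<k. \<forall>B \<in> carrier_mat q q. \<forall>C \<in> carrier_mat q q.
        \<Phi> (As[i := B + C]) = \<Phi> (As[i := B]) + \<Phi> (As[i := C])) \<and>
     (\<forall>As \<in> mat_tuples k q. \<forall>i<k. \<forall>B \<in> carrier_mat q q. \<forall>c.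
        \<Phi> (As[i := c \<cdot>\<^sub>m B]) = c \<cdot>\<^sub>m \<Phi> (As[i := B]))"

definition positive_map ::
    "nat \<Rightarrow> nat \<Rightarrow> nat \<Rightarrow> (complex mat list \<Rightarrow> complex mat) \<Rightarrow> bool" where
  "positive_map k q p \<Phi> \<longleftrightarrow>
     (\<forall>As \<in> mat_tuples k q. (\<forall>A \<in> set As. positive_mat q A) \<longrightarrow> positive_mat p (\<Phi> As))"

definition unital_map ::
    "nat \<Rightarrow> nat \<Rightarrow> nat \<Rightarrow> (complex mat list \<Rightarrow> complex mat) \<Rightarrow> bool" where
  "unital_map k q p \<Phi> \<longleftrightarrow> \<Phi> (replicate k (1\<^sub>m q)) = 1\<^sub>m p"

(* The two-factor inequality f(xy) <= f(x) f(y) yields the k-factor inequality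
   f(x_1 ... x_k) <= f(x_1) ... f(x_k) when f >= 0, and also when k = 1 or k is even,
   but not for odd k >= 3 without a sign condition: the constant f = -2 is
   sub-multiplicative and matrix convex, while for p = q = 1, k = 3 and
   Phi(a, b, c) = abc the inequality f(Phi(a, b, c)) <= Phi(f(a), f(b), f(c)) would read
   -2 <= -8.  In that range sub-multiplicative is therefore read as including f >= 0.
   Super-multiplicative needs no such proviso: f(x) >= f(sqrt x)^2 >= 0. *)
definition sign_condition :: "nat \<Rightarrow> (real \<Rightarrow> real) \<Rightarrow> bool" where
  "sign_condition k f \<longleftrightarrow> (odd k \<and> 3 \<le> k \<longrightarrow> (\<forall>x\<ge>0. 0 \<le> f x))"

end

theory Submission
  imports Defs
begin

text \<open>Write each \<open>A\<^sub>i\<close> as a combination of its rank one spectral projections. By multilinearity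
  \<open>\<Phi>(g(A\<^sub>1), \<dots>, g(A\<^sub>k))\<close> is, for every function \<open>g\<close> at once, the combination of the values of \<open>\<Phi>\<close> on
  tuples of projections with the products \<open>g(x\<^sub>1) \<cdots> g(x\<^sub>k)\<close> as coefficients, where \<open>x\<^sub>i\<close> runs through the
  eigenvalues of \<open>A\<^sub>i\<close>. These values of \<open>\<Phi>\<close> are positive and, as \<open>\<Phi>\<close> is unital, sum up to the identity.
  After a decomposition into rank one matrices this says that
  \<open>\<Phi>(g(A\<^sub>1), \<dots>, g(A\<^sub>k)) = W D W*\<close>, where \<open>W W* = 1\<close>, the matrix \<open>W\<close> does not depend on \<open>g\<close>, and \<open>D\<close> is
  the diagonal matrix of the products (\<open>unital_multilinear_compression\<close>).

  The theorem is thereby reduced to two facts. The first is the operator Jensen inequality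
  \<open>f(W D W*) \<le> W f(D) W*\<close> (\<open>matrix_convex_jensen\<close>), obtained from midpoint convexity by dilating \<open>W\<close> to a
  unitary matrix and averaging over a reflection. The second is the inequality
  \<open>f(x\<^sub>1 \<cdots> x\<^sub>k) \<le> f(x\<^sub>1) \<cdots> f(x\<^sub>k)\<close> for numbers (\<open>submultiplicative_prod_list\<close>), which is monotone
  under \<open>D \<mapsto> W D W*\<close>. For a function that takes negative values the second fact needs an
  argument of its own: convexity then forces the function to be nonpositive everywhere.

  The super-multiplicative case applies Jensen's inequality to \<open>- f\<close>; there
  \<open>f(x) \<ge> f(sqrt x)\<^sup>2 \<ge> 0\<close> makes the iteration over the factors immediate.

  The functional calculus and the Loewner order are accessible through the spectral
  theorem (\<open>hermitian_spectral_form\<close>), which is proved by Householder deflation.\<close>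

section \<open>Adjoints and unitary matrices\<close>

lemma mat_adjoint_dim [simp]:
  "dim_row (mat_adjoint A) = dim_col A" "dim_col (mat_adjoint A) = dim_row A"
  by (simp_all add: mat_adjoint_def)

lemma mat_adjoint_carrier [simp, intro]:
  "A \<in> carrier_mat n m \<Longrightarrow> mat_adjoint A \<in> carrier_mat m n"
  by (intro carrier_matI) auto

lemma mat_adjoint_index [simp]:
  fixes A :: "complex mat"
  shows "i < dim_col A \<Longrightarrow> j < dim_row A \<Longrightarrow> mat_adjoint A $$ (i,j) = cnj (A $$ (j,i))"
  by (simp add: mat_adjoint_def mat_of_rows_index)

lemma mat_adjoint_adjoint [simp]:
  fixes A :: "complex mat"
  shows "mat_adjoint (mat_adjoint A) = A"
  by (rule eq_matI) auto

lemma mat_mult_index: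
  "A \<in> carrier_mat n m \<Longrightarrow> B \<in> carrier_mat m l \<Longrightarrow> i < n \<Longrightarrow> j < l \<Longrightarrow>
    (A * B) $$ (i,j) = (\<Sum>k<m. A $$ (i,k) * B $$ (k,j))"
  by (auto simp: scalar_prod_def atLeast0LessThan)

lemma mat_adjoint_mult:
  fixes A :: "complex mat"
  assumes "A \<in> carrier_mat n m" "B \<in> carrier_mat m l"
  shows "mat_adjoint (A * B) = mat_adjoint B * mat_adjoint A"
proof (rule eq_matI)
  fix i j assume "i < dim_row (mat_adjoint B * mat_adjoint A)" "j < dim_col (mat_adjoint B * mat_adjoint A)"
  then have ij: "i < l" "j < n" using assms by auto
  have "mat_adjoint (A * B) $$ (i,j) = cnj ((A * B) $$ (j,i))"
    using assms ij by (intro mat_adjoint_index) auto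
  also have "\<dots> = (\<Sum>k<m. cnj (A $$ (j,k)) * cnj (B $$ (k,i)))"
    using assms ij by (simp only: mat_mult_index cnj_sum complex_cnj_mult)
  also have "\<dots> = (mat_adjoint B * mat_adjoint A) $$ (i,j)"
    using assms ij by (subst mat_mult_index[of _ l m _ n]) (auto intro!: sum.cong)
  finally show "mat_adjoint (A * B) $$ (i,j) = (mat_adjoint B * mat_adjoint A) $$ (i,j)" .
qed (use assms in auto)

lemma mat_adjoint_one [simp]: "mat_adjoint (1\<^sub>m n :: complex mat) = 1\<^sub>m n"
  by (rule eq_matI) auto

lemma mat_adjoint_four_block:
  fixes A :: "complex mat"
  assumes "A \<in> carrier_mat n1 m1" "B \<in> carrier_mat n1 m2" "C \<in> carrier_mat n2 m1" "D \<in> carrier_mat n2 m2"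
  shows "mat_adjoint (four_block_mat A B C D) =
    four_block_mat (mat_adjoint A) (mat_adjoint C) (mat_adjoint B) (mat_adjoint D)"
  using assms by (intro eq_matI) auto

lemma sandwich_index:
  fixes W :: "complex mat"
  assumes "W \<in> carrier_mat n m" "i < n" "j < n"
  shows "(W * mat_diag m c * mat_adjoint W) $$ (i,j) = (\<Sum>k<m. W $$ (i,k) * c k * cnj (W $$ (j,k)))"
proof -
  have "(W * mat_diag m c * mat_adjoint W) $$ (i,j)
      = (\<Sum>k<m. (W * mat_diag m c) $$ (i,k) * mat_adjoint W $$ (k,j))"
    using assms by (intro mat_mult_index[of _ n m _ n]) (auto intro!: mult_carrier_mat)
  then show ?thesis using assms by (auto simp: mat_diag_mult_right[of _ n])
qed

lemma sandwich_carrier [simp]: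
  "W \<in> carrier_mat n m \<Longrightarrow> W * mat_diag m c * mat_adjoint W \<in> carrier_mat n n"
  by auto

lemma unitary_matI:
  assumes "U \<in> carrier_mat n n" "U * mat_adjoint U = 1\<^sub>m n"
  shows "unitary_mat n U"
  unfolding unitary_mat_def
  using assms mat_mult_left_right_inverse[OF assms(1) mat_adjoint_carrier[OF assms(1)] assms(2)]
  by blast

lemma unitary_mat_mult:
  assumes "unitary_mat n U" "unitary_mat n V"
  shows "unitary_mat n (U * V)"
proof (rule unitary_matI)
  have c: "U \<in> carrier_mat n n" "V \<in> carrier_mat n n"
    using assms by (auto simp: unitary_mat_def)
  then show "U * V \<in> carrier_mat n n" by auto
  have "U * V * mat_adjoint (U * V) = U * V * (mat_adjoint V * mat_adjoint U)"
    by (simp add: mat_adjoint_mult[OF c])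
  also have "\<dots> = U * (V * (mat_adjoint V * mat_adjoint U))"
    using c by (intro assoc_mult_mat[of _ n n _ n _ n]) auto
  also have "V * (mat_adjoint V * mat_adjoint U) = V * mat_adjoint V * mat_adjoint U"
    using c by (intro assoc_mult_mat[of _ n n _ n _ n, symmetric]) auto
  also have "\<dots> = mat_adjoint U"
    using assms(2) c by (simp add: unitary_mat_def)
  also have "U * mat_adjoint U = 1\<^sub>m n"
    using assms(1) by (simp add: unitary_mat_def)
  finally show "U * V * mat_adjoint (U * V) = 1\<^sub>m n" .
qed

text \<open>A direct sum of unitary matrices is unitary; this drives both the deflation step of the spectral
  theorem and the functional calculus of block diagonal matrices.\<close>

lemma unitary_mat_block:
  assumes "unitary_mat n U" "unitary_mat m V"
  shows "unitary_mat (n + m) (four_block_mat U (0\<^sub>m n m) (0\<^sub>m m n) V)"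
proof (rule unitary_matI)
  have c: "U \<in> carrier_mat n n" "V \<in> carrier_mat m m"
    and u: "U * mat_adjoint U = 1\<^sub>m n" "V * mat_adjoint V = 1\<^sub>m m"
    using assms by (auto simp: unitary_mat_def)
  have z: "mat_adjoint (0\<^sub>m a b :: complex mat) = 0\<^sub>m b a" for a b by (rule eq_matI) auto
  show "four_block_mat U (0\<^sub>m n m) (0\<^sub>m m n) V \<in> carrier_mat (n + m) (n + m)" using c by simp
  show "four_block_mat U (0\<^sub>m n m) (0\<^sub>m m n) V *
      mat_adjoint (four_block_mat U (0\<^sub>m n m) (0\<^sub>m m n) V) = 1\<^sub>m (n + m)"
    using c u by (simp add: mat_adjoint_four_block[where ?n1.0=n and ?m1.0=n and ?n2.0=m and ?m2.0=m] z
        mult_four_block_mat[where ?nr1.0=n and ?n1.0=n and ?nr2.0=m and ?n2.0=m and ?nc1.0=n and ?nc2.0=m])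
qed

section \<open>Diagonalization and functional calculus\<close>

text \<open>Diagonalizations are kept as data, since the functional calculus is computed from whichever
  diagonalization is at hand.\<close>

definition spectral_form :: "nat \<Rightarrow> complex mat \<Rightarrow> complex mat \<Rightarrow> (nat \<Rightarrow> real) \<Rightarrow> bool" where
  "spectral_form n A U d \<longleftrightarrow>
     unitary_mat n U \<and> A = U * mat_diag n (\<lambda>i. complex_of_real (d i)) * mat_adjoint U"

lemma spectral_form_carrier: "spectral_form n A U d \<Longrightarrow> A \<in> carrier_mat n n"
  by (auto simp: spectral_form_def unitary_mat_def)

text \<open>The description in the definition of \<open>mat_fun\<close> determines a matrix because two
  diagonalizations of one matrix differ by a unitary matrix that only mixes eigenvectors of equal
  eigenvalues.\<close>

lemma mat_fun_spectral_form:
  assumes "spectral_form n A U d"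
  shows "mat_fun f A = U * mat_diag n (\<lambda>i. complex_of_real (f (d i))) * mat_adjoint U"
proof -
  have A: "A \<in> carrier_mat n n" by (rule spectral_form_carrier[OF assms])
  then have n: "dim_row A = n" by auto
  have unique: "V * mat_diag n (\<lambda>i. complex_of_real (f (e i))) * mat_adjoint V =
      U * mat_diag n (\<lambda>i. complex_of_real (f (d i))) * mat_adjoint U"
    if "spectral_form n A V e" for V e
  proof -
    let ?D = "\<lambda>d. mat_diag n (\<lambda>i. complex_of_real (d i))"
    have U: "U \<in> carrier_mat n n" "mat_adjoint U * U = 1\<^sub>m n" "U * mat_adjoint U = 1\<^sub>m n"
      and V: "V \<in> carrier_mat n n" "mat_adjoint V * V = 1\<^sub>m n" "V * mat_adjoint V = 1\<^sub>m n"
      and eq: "U * ?D d * mat_adjoint U = V * ?D e * mat_adjoint V"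
      using assms that by (auto simp: spectral_form_def unitary_mat_def)
    note cs = U(1) V(1) mat_adjoint_carrier[OF U(1)] mat_adjoint_carrier[OF V(1)]
    note ac = assoc_mult_mat[of _ n n _ n _ n] mult_carrier_mat[of _ n n _ n]
    \<comment> \<open>The change of basis between the two eigenbases intertwines the two diagonal matrices.\<close>
    define W where "W = mat_adjoint V * U"
    have W: "W \<in> carrier_mat n n" using cs by (auto simp: W_def)
    have canV: "mat_adjoint V * (V * X) = X" if "X \<in> carrier_mat n n" for X
      using V that assoc_mult_mat[of "mat_adjoint V" n n V n X n] by auto
    have canV': "V * (mat_adjoint V * X) = X" if "X \<in> carrier_mat n n" for X
      using V that assoc_mult_mat[of V n n "mat_adjoint V" n X n] by auto
    have swap: "mat_adjoint V * (U * ?D h * mat_adjoint U) * U = W * ?D h" for h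
    proof -
      have "mat_adjoint V * (U * ?D h * mat_adjoint U) * U = mat_adjoint V * (U * (?D h * (mat_adjoint U * U)))"
        using cs by (simp add: ac)
      also have "\<dots> = W * ?D h"
        using cs U by (simp add: ac right_mult_one_mat[of _ n n] W_def)
      finally show ?thesis .
    qed
    have swap': "mat_adjoint V * (V * ?D h * mat_adjoint V) * U = ?D h * W" for h
      using cs by (simp add: ac W_def canV)
    have "W * ?D d = ?D e * W"
      using swap[of d] swap'[of e] unfolding eq by simp
    then have entry: "W $$ (i,j) * d j = e i * W $$ (i,j)" if "i < n" "j < n" for i j
    proof -
      have "(W * ?D d) $$ (i,j) = (?D e * W) $$ (i,j)" by (simp only: \<open>W * ?D d = ?D e * W\<close>)
      then show ?thesis using that by (simp add: mat_diag_mult_right[OF W] mat_diag_mult_left[OF W])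
    qed
    have "W * ?D (\<lambda>i. f (d i)) = ?D (\<lambda>i. f (e i)) * W"
    proof (rule eq_matI)
      fix i j assume "i < dim_row (?D (\<lambda>i. f (e i)) * W)" "j < dim_col (?D (\<lambda>i. f (e i)) * W)"
      then have ij: "i < n" "j < n" using W by (auto simp: mat_diag_def)
      \<comment> \<open>A nonzero entry links equal eigenvalues only, so \<open>f\<close> may be applied to both sides.\<close>
      have "W $$ (i,j) = 0 \<or> d j = e i" using entry[OF ij] by (auto simp: mult.commute)
      then show "(W * ?D (\<lambda>i. f (d i))) $$ (i,j) = (?D (\<lambda>i. f (e i)) * W) $$ (i,j)"
        using ij by (auto simp: mat_diag_mult_right[OF W] mat_diag_mult_left[OF W])
    qed (use W in \<open>auto simp: mat_diag_def\<close>)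
    then have "V * (W * ?D (\<lambda>i. f (d i))) * mat_adjoint U = V * (?D (\<lambda>i. f (e i)) * W) * mat_adjoint U"
      by simp
    then show ?thesis
      using cs U by (simp add: ac W_def canV')
  qed
  show ?thesis
    unfolding mat_fun_def n
  proof (rule the_equality)
    show "\<exists>V e. unitary_mat n V \<and> A = V * mat_diag n (\<lambda>i. complex_of_real (e i)) * mat_adjoint V \<and>
       U * mat_diag n (\<lambda>i. complex_of_real (f (d i))) * mat_adjoint U =
       V * mat_diag n (\<lambda>i. complex_of_real (f (e i))) * mat_adjoint V"
      using assms unfolding spectral_form_def by blast
  next
    fix B assume "\<exists>V e. unitary_mat n V \<and> A = V * mat_diag n (\<lambda>i. complex_of_real (e i)) * mat_adjoint V \<and>
       B = V * mat_diag n (\<lambda>i. complex_of_real (f (e i))) * mat_adjoint V"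
    then show "B = U * mat_diag n (\<lambda>i. complex_of_real (f (d i))) * mat_adjoint U"
      using unique unfolding spectral_form_def by blast
  qed
qed

section \<open>The spectral theorem for Hermitian matrices\<close>

lemma hermitian_matD:
  assumes "hermitian_mat n A"
  shows "A \<in> carrier_mat n n" "mat_adjoint A = A"
    "i < n \<Longrightarrow> j < n \<Longrightarrow> cnj (A $$ (i,j)) = A $$ (j,i)"
proof -
  show A: "A \<in> carrier_mat n n" "mat_adjoint A = A" using assms by (auto simp: hermitian_mat_def)
  show "cnj (A $$ (i,j)) = A $$ (j,i)" if "i < n" "j < n"
    using A that by (metis carrier_matD mat_adjoint_index)
qed

lemma hermitian_matI:
  assumes "A \<in> carrier_mat n n" "\<And>i j. i < n \<Longrightarrow> j < n \<Longrightarrow> cnj (A $$ (i,j)) = A $$ (j,i)"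
  shows "hermitian_mat n A"
  using assms unfolding hermitian_mat_def by (auto intro!: eq_matI)

lemma spectral_form_conj:
  assumes V: "unitary_mat n V" and A: "spectral_form n A U d"
  shows "spectral_form n (V * A * mat_adjoint V) (V * U) d"
proof -
  have c: "V \<in> carrier_mat n n" "U \<in> carrier_mat n n" and "unitary_mat n U"
    using assms by (auto simp: spectral_form_def unitary_mat_def)
  then show ?thesis
    using assms mat_adjoint_carrier[OF c(1)] mat_adjoint_carrier[OF c(2)]
    by (simp add: spectral_form_def unitary_mat_mult mat_adjoint_mult[of _ n n _ n]
        assoc_mult_mat[of _ n n _ n _ n] mult_carrier_mat[of _ n n _ n])
qed

lemma mat_diag_four_block:
  "mat_diag (n + m) (\<lambda>i. if i < n then c i else e (i - n)) =
    four_block_mat (mat_diag n c) (0\<^sub>m n m) (0\<^sub>m m n) (mat_diag m e)"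
  by (rule eq_matI) (auto simp: mat_diag_def)

lemma spectral_form_block:
  assumes "spectral_form n A U d" "spectral_form m B V e"
  shows "spectral_form (n + m) (four_block_mat A (0\<^sub>m n m) (0\<^sub>m m n) B)
    (four_block_mat U (0\<^sub>m n m) (0\<^sub>m m n) V) (\<lambda>i. if i < n then d i else e (i - n))"
proof -
  have c: "U \<in> carrier_mat n n" "V \<in> carrier_mat m m"
    and u: "unitary_mat n U" "unitary_mat m V"
    and eq: "A = U * mat_diag n (\<lambda>i. complex_of_real (d i)) * mat_adjoint U"
     "B = V * mat_diag m (\<lambda>i. complex_of_real (e i)) * mat_adjoint V"
    using assms by (auto simp: spectral_form_def unitary_mat_def)
  have z: "mat_adjoint (0\<^sub>m a b :: complex mat) = 0\<^sub>m b a" for a b by (rule eq_matI) auto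
  have d: "mat_diag (n + m) (\<lambda>i. complex_of_real (if i < n then d i else e (i - n))) =
    four_block_mat (mat_diag n (\<lambda>i. complex_of_real (d i))) (0\<^sub>m n m) (0\<^sub>m m n)
     (mat_diag m (\<lambda>i. complex_of_real (e i)))"
    unfolding mat_diag_four_block[symmetric] by (rule arg_cong[of _ _ "mat_diag (n + m)"]) auto
  note mult = mult_four_block_mat[where ?nr1.0=n and ?n1.0=n and ?nr2.0=m and ?n2.0=m and ?nc1.0=n and ?nc2.0=m]
  have ca: "mat_adjoint U \<in> carrier_mat n n" "mat_adjoint V \<in> carrier_mat m m" using c by auto
  have cd: "U * mat_diag n x \<in> carrier_mat n n" "V * mat_diag m x \<in> carrier_mat m m" for x
    using c by auto
  have zd: "0\<^sub>m a b * mat_diag b x = (0\<^sub>m a b :: complex mat)" for a b x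
    by (rule left_mult_zero_mat) simp
  show ?thesis
    unfolding spectral_form_def d
      mat_adjoint_four_block[OF c(1) zero_carrier_mat zero_carrier_mat c(2)] z
    using c cd ca u eq
    by (simp add: unitary_mat_block mult zd right_mult_zero_mat[OF cd(1)] right_mult_zero_mat[OF cd(2)])
qed

lemma mat_adjoint_real_diag: "mat_adjoint (mat_diag n (\<lambda>i. complex_of_real (c i))) = mat_diag n (\<lambda>i. complex_of_real (c i))"
  by (rule eq_matI) (auto simp: mat_diag_def)

lemma hermitian_sandwich:
  assumes "W \<in> carrier_mat n m"
  shows "hermitian_mat n (W * mat_diag m (\<lambda>i. complex_of_real (c i)) * mat_adjoint W)"
proof (rule hermitian_matI)
  show "W * mat_diag m (\<lambda>i. complex_of_real (c i)) * mat_adjoint W \<in> carrier_mat n n"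
    using assms by simp
qed (simp add: sandwich_index[OF assms] cnj_sum mult_ac)

lemma spectral_form_hermitian: "spectral_form n A U d \<Longrightarrow> hermitian_mat n A"
  using hermitian_sandwich unfolding spectral_form_def unitary_mat_def by blast

text \<open>Reflect in the hyperplane orthogonal to \<open>w - e\<close>, where \<open>e\<close> is the first unit vector. A
  reflection is Hermitian, hence can map \<open>e\<close> to \<open>w\<close> only if the inner product \<open>w 0\<close> of the two is real.\<close>

lemma householder:
  fixes w :: "nat \<Rightarrow> complex"
  assumes norm: "(\<Sum>i<n. w i * cnj (w i)) = 1" and real: "w 0 \<in> \<real>" and n: "0 < n"
  shows "\<exists>H. hermitian_mat n H \<and> H * H = 1\<^sub>m n \<and> (\<forall>i<n. H $$ (i,0) = w i)"
proof -
  define \<delta> where "\<delta> = (\<lambda>i j::nat. if i = j then 1 else 0 :: complex)"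
  define z where "z = (\<lambda>i. w i - \<delta> i 0)"
  \<comment> \<open>Since \<open>w 0\<close> is real, \<open>z\<close> has squared norm \<open>2 - 2 * w 0\<close>, so \<open>c\<close> is the factor
    \<open>2 / (z* z)\<close> of the reflection that maps the first unit vector to \<open>w\<close>.\<close>
  define c where "c = 1 / (1 - w 0)"
  define H where "H = mat n n (\<lambda>(i,j). \<delta> i j - c * z i * cnj (z j))"
  have cr: "cnj c = c" "cnj (w 0) = w 0" using real by (auto simp: c_def complex_is_Real_iff complex_eq_iff Reals_cnj_iff)
  have sym: "cnj (\<delta> i j) = \<delta> j i" for i j by (auto simp: \<delta>_def)
  have pick: "(\<Sum>k<n. \<delta> i k * g k) = g i" "(\<Sum>k<n. g k * \<delta> k i) = g i" if "i < n" for i and g :: "nat \<Rightarrow> complex"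
    using that by (auto simp: \<delta>_def if_distrib[of "\<lambda>x. x * _"] if_distrib[of "\<lambda>x. _ * x"] cong: if_cong)
  have t: "(\<Sum>k<n. z k * cnj (z k)) = 2 - 2 * w 0"
  proof -
    have "(\<Sum>k<n. z k * cnj (z k)) = (\<Sum>k<n. w k * cnj (w k)) - (\<Sum>k<n. w k * \<delta> k 0) -
        (\<Sum>k<n. \<delta> 0 k * cnj (w k)) + (\<Sum>k<n. \<delta> 0 k * \<delta> k 0)"
      unfolding sum_subtractf[symmetric] sum.distrib[symmetric]
      by (intro sum.cong) (auto simp: z_def sym \<delta>_def algebra_simps)
    also have "\<dots> = 2 - 2 * w 0"
      using n norm cr by (simp add: pick) (simp add: \<delta>_def)
    finally show ?thesis .
  qed
  have "hermitian_mat n H"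
    by (rule hermitian_matI) (auto simp: H_def sym cr)
  moreover have "H * H = 1\<^sub>m n"
  proof (rule eq_matI)
    fix i j assume "i < dim_row (1\<^sub>m n :: complex mat)" "j < dim_col (1\<^sub>m n :: complex mat)"
    then have ij: "i < n" "j < n" by auto
    have "(H * H) $$ (i,j) = (\<Sum>k<n. H $$ (i,k) * H $$ (k,j))"
      using ij by (intro mat_mult_index[of _ n n _ n]) (auto simp: H_def)
    also have "\<dots> = (\<Sum>k<n. \<delta> i k * \<delta> k j) - (\<Sum>k<n. \<delta> i k * (c * z k * cnj (z j)))
       - (\<Sum>k<n. (c * z i * cnj (z k)) * \<delta> k j) + c * c * z i * cnj (z j) * (\<Sum>k<n. z k * cnj (z k))"
      unfolding sum_subtractf[symmetric] sum.distrib[symmetric] sum_distrib_left using ij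
      by (intro sum.cong) (auto simp: H_def algebra_simps)
    also have "\<dots> = \<delta> i j + c * z i * cnj (z j) * (c * (2 - 2 * w 0) - 2)"
      using ij unfolding t by (simp only: pick) (simp add: algebra_simps)
    also have "c * z i * (c * (2 - 2 * w 0) - 2) = 0"
      by (auto simp: c_def field_simps)
    then have "c * z i * cnj (z j) * (c * (2 - 2 * w 0) - 2) = 0" by auto
    finally show "(H * H) $$ (i,j) = 1\<^sub>m n $$ (i,j)"
      using ij by (simp add: \<delta>_def)
  qed (auto simp: H_def)
  moreover have "H $$ (i,0) = w i" if i: "i < n" for i
  proof (cases "w 0 = 1")
    case False
    then have "c * (w 0 - 1) = -1" by (simp add: c_def field_simps)
    then have "c * z i * (w 0 - 1) = - z i" by (metis mult.commute mult.left_commute mult_minus1_right)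
    then show ?thesis using i n cr by (simp add: H_def) (simp add: z_def \<delta>_def)
  next
    case True
    \<comment> \<open>Here \<open>w\<close> is the first unit vector: the division by zero gives \<open>c = 0\<close> and \<open>H = 1\<close>.\<close>
    have "(\<Sum>k<n. z k * cnj (z k)) = of_real (\<Sum>k<n. (cmod (z k))\<^sup>2)"
      by (simp only: of_real_sum complex_norm_square)
    then have "(\<Sum>k<n. (cmod (z k))\<^sup>2) = 0" using t True by (metis cancel_comm_monoid_add_class.diff_cancel mult.right_neutral of_real_eq_0_iff)
    then have "z i = 0" using i by (subst (asm) sum_nonneg_eq_0_iff) auto
    then show ?thesis using i n by (simp add: H_def) (simp add: z_def)
  qed
  ultimately show ?thesis by blast
qed

text \<open>Deflation: an eigenvector is moved to the first unit vector by a Householder reflection; the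
  remaining block is Hermitian of smaller size and is diagonalized by induction.\<close>

lemma hermitian_spectral_form:
  "hermitian_mat n A \<Longrightarrow> \<exists>U d. spectral_form n A U d"
proof (induction n arbitrary: A)
  case 0
  then have "A \<in> carrier_mat 0 0" by (auto simp: hermitian_mat_def)
  then have "spectral_form 0 A (1\<^sub>m 0) (\<lambda>_. 0)"
    by (auto simp: spectral_form_def unitary_mat_def)
  then show ?case by blast
next
  case (Suc n)
  let ?n = "Suc n"
  have A: "A \<in> carrier_mat ?n ?n" using Suc.prems by (rule hermitian_matD)
  obtain e v where "eigenvector A v e"
    using spectrum_non_empty[OF A] by (auto simp: spectrum_def eigenvalue_def)
  then have v: "v \<in> carrier_vec ?n" "v \<noteq> 0\<^sub>v ?n" "A *\<^sub>v v = e \<cdot>\<^sub>v v"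
    using A by (auto simp: eigenvector_def)
  define s where "s = (\<Sum>i<?n. (cmod (v $ i))\<^sup>2)"
  obtain i where i: "i < ?n" "v $ i \<noteq> 0" using v(1,2) by (metis carrier_vecD eq_vecI index_zero_vec)
  have "0 < (cmod (v $ i))\<^sup>2" using i by simp
  also have "\<dots> \<le> s" unfolding s_def using i by (intro member_le_sum) auto
  finally have s: "0 < s" .
  \<comment> \<open>Besides the norm, the phase is adjusted so that the entry with index 0 becomes real.\<close>
  define a where "a = (if v $ 0 = 0 then 1 else cnj (sgn (v $ 0))) / of_real (sqrt s)"
  define w where "w i = a * v $ i" for i
  have a: "(cmod a)\<^sup>2 = 1 / s"
    using s by (auto simp: a_def norm_divide norm_mult norm_sgn power_divide)
  have "(\<Sum>i<?n. w i * cnj (w i)) = of_real ((cmod a)\<^sup>2 * s)"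
    unfolding s_def sum_distrib_left of_real_sum w_def complex_norm_square[symmetric]
    by (intro sum.cong refl) (simp only: norm_mult power_mult_distrib)
  then have norm: "(\<Sum>i<?n. w i * cnj (w i)) = 1" using s by (simp add: a)
  have "cnj (sgn x) * x = of_real (cmod x)" for x
  proof -
    have "cnj (sgn x) * x = (x * cnj x) / of_real (cmod x)" by (simp add: sgn_eq)
    also have "\<dots> = of_real ((cmod x)\<^sup>2 / cmod x)" by (simp only: complex_norm_square of_real_divide)
    finally show ?thesis by (simp add: power2_eq_square)
  qed
  then have "w 0 = (if v $ 0 = 0 then 0 else of_real (cmod (v $ 0) / sqrt s))"
    by (simp add: w_def a_def)
  then have "w 0 \<in> \<real>" by simp
  from householder[OF norm this] obtain H where
    H: "hermitian_mat ?n H" "H * H = 1\<^sub>m ?n" "\<And>i. i < ?n \<Longrightarrow> H $$ (i,0) = w i" by auto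
  have Hc: "H \<in> carrier_mat ?n ?n" and Ha: "mat_adjoint H = H" using H(1) by (rule hermitian_matD)+
  have Hu: "unitary_mat ?n H" using H(2) Hc Ha by (simp add: unitary_mat_def)
  \<comment> \<open>In the basis given by \<open>H\<close> the eigenvector is the first unit vector, so the first column of
    \<open>B\<close>, and by symmetry its first row, vanishes off the diagonal.\<close>
  define B where "B = H * (A * H)"
  have AH: "A * H \<in> carrier_mat ?n ?n" using A Hc by auto
  have Bc: "B \<in> carrier_mat ?n ?n" unfolding B_def using Hc AH by auto
  have Ba: "hermitian_mat ?n B"
    unfolding hermitian_mat_def
  proof
    have "mat_adjoint B = H * A * H"
      unfolding B_def mat_adjoint_mult[OF Hc AH] mat_adjoint_mult[OF A Hc] Ha hermitian_matD(2)[OF Suc.prems] ..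
    then show "mat_adjoint B = B" unfolding B_def using Hc A by (simp add: assoc_mult_mat[of _ ?n ?n _ ?n _ ?n])
  qed (rule Bc)
  have Av: "(\<Sum>l<?n. A $$ (k,l) * w l) = e * w k" if "k < ?n" for k
  proof -
    have "(A *\<^sub>v v) $ k = (\<Sum>l<?n. A $$ (k,l) * v $ l)"
      using A v(1) that by (auto simp: scalar_prod_def atLeast0LessThan)
    then have eig: "(\<Sum>l<?n. A $$ (k,l) * v $ l) = e * v $ k" using v that by simp
    have "(\<Sum>l<?n. A $$ (k,l) * w l) = a * (\<Sum>l<?n. A $$ (k,l) * v $ l)"
      unfolding w_def sum_distrib_left by (intro sum.cong) auto
    also have "\<dots> = e * w k" using eig by (simp add: w_def)
    finally show ?thesis .
  qed
  have col: "B $$ (i,0) = (if i = 0 then e else 0)" if "i < ?n" for i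
  proof -
    have AH0: "(A * H) $$ (k,0) = e * H $$ (k,0)" if "k < ?n" for k
      unfolding mat_mult_index[OF A Hc that zero_less_Suc] H(3)[OF that] Av[OF that, symmetric]
      by (intro sum.cong) (auto simp: H(3))
    have "B $$ (i,0) = (\<Sum>k<?n. H $$ (i,k) * (e * H $$ (k,0)))"
      unfolding B_def mat_mult_index[OF Hc AH that zero_less_Suc]
      by (intro sum.cong refl) (simp add: AH0)
    also have "\<dots> = e * (H * H) $$ (i,0)"
      unfolding mat_mult_index[OF Hc Hc that zero_less_Suc] sum_distrib_left
      by (intro sum.cong) auto
    finally show ?thesis using that by (simp add: H(2))
  qed
  have row: "B $$ (0,j) = (if j = 0 then e else 0)" if "j < ?n" for j
    using hermitian_matD(3)[OF Ba that zero_less_Suc] hermitian_matD(3)[OF Ba zero_less_Suc that] col[OF that]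
    by (auto split: if_splits)
  have er: "e = of_real (Re e)" using hermitian_matD(3)[OF Ba, of 0 0] col[of 0] by (simp add: Reals_cnj_iff[symmetric])
  define C where "C = mat n n (\<lambda>(i,j). B $$ (Suc i, Suc j))"
  have "hermitian_mat n C"
    by (rule hermitian_matI) (auto simp: C_def hermitian_matD(3)[OF Ba])
  then obtain V d where V: "spectral_form n C V d" using Suc.IH by blast
  have one: "spectral_form 1 (mat 1 1 (\<lambda>_. e)) (1\<^sub>m 1) (\<lambda>_. Re e)"
    unfolding spectral_form_def
  proof (intro conjI eq_matI)
    show "unitary_mat 1 (1\<^sub>m 1)" by (auto simp: unitary_mat_def)
  qed (use er in \<open>auto simp: mat_diag_def\<close>)
  have Bb: "B = four_block_mat (mat 1 1 (\<lambda>_. e)) (0\<^sub>m 1 n) (0\<^sub>m n 1) C"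
    using Bc by (intro eq_matI) (auto simp: C_def col row)
  have "\<exists>U d. spectral_form ?n B U d"
    using spectral_form_block[OF one V] unfolding Bb by auto
  then obtain U d where U: "spectral_form ?n B U d" by blast
  have "H * B * mat_adjoint H = (H * H) * A * (H * H)"
    unfolding Ha B_def using Hc A by (simp add: assoc_mult_mat[of _ ?n ?n _ ?n _ ?n] mult_carrier_mat[of _ ?n ?n _ ?n])
  then have "H * B * mat_adjoint H = A" using A by (simp add: H(2))
  then show ?case using spectral_form_conj[OF Hu U] by auto
qed

section \<open>Positivity and quadratic forms\<close>

text \<open>Vectors are functions on the natural numbers here, so that a vector for a leading block can be
  padded with zeros without changing its type.\<close>

definition quad_form :: "nat \<Rightarrow> complex mat \<Rightarrow> (nat \<Rightarrow> complex) \<Rightarrow> complex" where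
  "quad_form n A v = (\<Sum>i<n. \<Sum>j<n. cnj (v i) * A $$ (i,j) * v j)"

lemma quad_form_minus:
  assumes "A \<in> carrier_mat n n" "B \<in> carrier_mat n n"
  shows "quad_form n (A - B) v = quad_form n A v - quad_form n B v"
  using assms by (auto simp: quad_form_def sum_subtractf[symmetric] algebra_simps intro!: sum.cong)

text \<open>Matrices of the form \<open>W D W*\<close> with \<open>D\<close> diagonal carry all later estimates: their quadratic
  forms are sums of squared moduli weighted by the diagonal of \<open>D\<close>.\<close>

lemma quad_form_sandwich:
  assumes W: "W \<in> carrier_mat n m"
  shows "quad_form n (W * mat_diag m c * mat_adjoint W) v =
    (\<Sum>k<m. c k * of_real ((cmod (\<Sum>i<n. cnj (v i) * W $$ (i,k)))\<^sup>2))"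
proof -
  have "quad_form n (W * mat_diag m c * mat_adjoint W) v =
      (\<Sum>i<n. \<Sum>j<n. \<Sum>k<m. c k * ((cnj (v i) * W $$ (i,k)) * (cnj (W $$ (j,k)) * v j)))"
    unfolding quad_form_def
    by (intro sum.cong refl) (auto simp: sandwich_index[OF W] sum_distrib_left sum_distrib_right mult_ac)
  also have "\<dots> = (\<Sum>i<n. \<Sum>k<m. \<Sum>j<n. c k * ((cnj (v i) * W $$ (i,k)) * (cnj (W $$ (j,k)) * v j)))"
    by (intro sum.cong refl sum.swap)
  also have "\<dots> = (\<Sum>k<m. \<Sum>i<n. \<Sum>j<n. c k * ((cnj (v i) * W $$ (i,k)) * (cnj (W $$ (j,k)) * v j)))"
    by (rule sum.swap)
  also have "\<dots> = (\<Sum>k<m. c k * ((\<Sum>i<n. cnj (v i) * W $$ (i,k)) * cnj (\<Sum>i<n. cnj (v i) * W $$ (i,k))))"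
    unfolding sum_product cnj_sum
    by (intro sum.cong refl) (simp add: sum_distrib_left mult_ac)
  finally show ?thesis unfolding complex_norm_square .
qed

lemma quad_form_hermitian_real:
  assumes "hermitian_mat n A"
  shows "quad_form n A v \<in> \<real>"
proof -
  have "cnj (quad_form n A v) = (\<Sum>i<n. \<Sum>j<n. cnj (v j) * A $$ (j,i) * v i)"
    unfolding quad_form_def cnj_sum
    by (intro sum.cong refl) (auto simp: hermitian_matD(3)[OF assms] mult_ac)
  also have "\<dots> = quad_form n A v" unfolding quad_form_def by (rule sum.swap)
  finally show ?thesis by (simp add: Reals_cnj_iff)
qed

text \<open>The columns of \<open>U\<close> are eigenvectors, so the entries of \<open>d\<close> are eigenvalues.\<close>

lemma spectral_form_nonneg:
  assumes "positive_mat n A" and S: "spectral_form n A U d" and k: "k < n"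
  shows "0 \<le> d k"
proof -
  have U: "U \<in> carrier_mat n n" "mat_adjoint U * U = 1\<^sub>m n"
    and A: "A = U * mat_diag n (\<lambda>i. complex_of_real (d i)) * mat_adjoint U"
    using S by (auto simp: spectral_form_def unitary_mat_def)
  let ?D = "mat_diag n (\<lambda>i. complex_of_real (d i))"
  have Ac: "A \<in> carrier_mat n n" by (rule spectral_form_carrier[OF S])
  have AU: "A * U = U * ?D"
    unfolding A using U mat_adjoint_carrier[OF U(1)]
    by (simp add: assoc_mult_mat[of _ n n _ n _ n] mult_carrier_mat[of _ n n _ n] right_mult_one_mat[of _ n n])
  have "col U k \<noteq> 0\<^sub>v n"
  proof
    assume 0: "col U k = 0\<^sub>v n"
    have Uik: "U $$ (i,k) = 0" if "i < n" for i
      using arg_cong[OF 0, of "\<lambda>v. v $ i"] that U(1) k by auto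
    have "(mat_adjoint U * U) $$ (k,k) = 0"
      unfolding mat_mult_index[OF mat_adjoint_carrier[OF U(1)] U(1) k k]
      by (intro sum.neutral) (auto simp: Uik)
    then show False using U(2) k by simp
  qed
  moreover have "A *\<^sub>v col U k = complex_of_real (d k) \<cdot>\<^sub>v col U k"
  proof (rule eq_vecI)
    fix i assume "i < dim_vec (complex_of_real (d k) \<cdot>\<^sub>v col U k)"
    then have i: "i < n" using U(1) by auto
    have "(A *\<^sub>v col U k) $ i = (A * U) $$ (i,k)" using Ac U(1) i k by auto
    also have "\<dots> = U $$ (i,k) * d k"
      unfolding AU using i k by (simp add: mat_diag_mult_right[OF U(1)])
    finally show "(A *\<^sub>v col U k) $ i = (complex_of_real (d k) \<cdot>\<^sub>v col U k) $ i"
      using U(1) i k by (simp add: mult.commute)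
  qed (use Ac U in auto)
  ultimately have "eigenvector A (col U k) (complex_of_real (d k))"
    using Ac U(1) by (auto simp: eigenvector_def)
  then have "eigenvalue A (complex_of_real (d k))" by (auto simp: eigenvalue_def)
  then have "0 \<le> Re (complex_of_real (d k))" using assms(1) unfolding positive_mat_def by blast
  then show ?thesis by simp
qed

text \<open>From eigenvalues to the form: diagonalize. From the form to eigenvalues: insert an eigenvector,
  whose eigenvalue is then a quotient of two real numbers.\<close>

lemma positive_mat_iff_quad_form:
  "positive_mat n A \<longleftrightarrow> hermitian_mat n A \<and> (\<forall>v. 0 \<le> Re (quad_form n A v))"
proof (intro iffI conjI allI)
  assume pos: "positive_mat n A"
  then show "hermitian_mat n A" by (simp add: positive_mat_def)
  then obtain U d where S: "spectral_form n A U d" using hermitian_spectral_form by blast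
  then have U: "U \<in> carrier_mat n n" and A: "A = U * mat_diag n (\<lambda>i. complex_of_real (d i)) * mat_adjoint U"
    by (auto simp: spectral_form_def unitary_mat_def)
  show "0 \<le> Re (quad_form n A v)" for v
    unfolding A quad_form_sandwich[OF U] Re_sum
    by (intro sum_nonneg) (use spectral_form_nonneg[OF pos S] in \<open>auto simp flip: of_real_mult\<close>)
next
  assume A: "hermitian_mat n A \<and> (\<forall>v. 0 \<le> Re (quad_form n A v))"
  then have Ac: "A \<in> carrier_mat n n" by (auto simp: hermitian_mat_def)
  have "e \<in> \<real> \<and> 0 \<le> Re e" if ev: "eigenvalue A e" for e
  proof -
    obtain v where "eigenvector A v e" using ev by (auto simp: eigenvalue_def)
    then have v: "v \<in> carrier_vec n" "v \<noteq> 0\<^sub>v n" "A *\<^sub>v v = e \<cdot>\<^sub>v v"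
      using Ac by (auto simp: eigenvector_def)
    define s where "s = (\<Sum>i<n. (cmod (v $ i))\<^sup>2)"
    obtain i where i: "i < n" "v $ i \<noteq> 0" using v(1,2) by (metis carrier_vecD eq_vecI index_zero_vec)
    have "0 < (cmod (v $ i))\<^sup>2" using i by simp
    also have "\<dots> \<le> s" unfolding s_def using i by (intro member_le_sum) auto
    finally have s: "0 < s" .
    have row: "(\<Sum>j<n. A $$ (i,j) * v $ j) = e * v $ i" if "i < n" for i
    proof -
      have "(A *\<^sub>v v) $ i = (\<Sum>j<n. A $$ (i,j) * v $ j)"
        using Ac v(1) that by (auto simp: scalar_prod_def atLeast0LessThan)
      then show ?thesis using v that by simp
    qed
    have "quad_form n A (\<lambda>i. v $ i) = (\<Sum>i<n. cnj (v $ i) * (\<Sum>j<n. A $$ (i,j) * v $ j))"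
      by (simp add: quad_form_def sum_distrib_left mult.assoc)
    also have "\<dots> = (\<Sum>i<n. e * (v $ i * cnj (v $ i)))"
      by (intro sum.cong refl) (simp add: row)
    also have "\<dots> = e * of_real s"
      by (simp only: s_def of_real_sum complex_norm_square sum_distrib_left)
    finally have q: "quad_form n A (\<lambda>i. v $ i) = e * of_real s" .
    then have "e = quad_form n A (\<lambda>i. v $ i) / of_real s" using s by simp
    moreover have "quad_form n A (\<lambda>i. v $ i) \<in> \<real>"
      using A quad_form_hermitian_real by blast
    ultimately have "e \<in> \<real>" by simp
    moreover have "0 \<le> Re (e * of_real s)" using A unfolding q[symmetric] by blast
    then have "0 \<le> Re e * s" by simp
    ultimately show ?thesis using s by (simp add: zero_le_mult_iff)
  qed
  then show "positive_mat n A" using A by (simp add: positive_mat_def)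
qed

lemma hermitian_minus:
  assumes "hermitian_mat n A" "hermitian_mat n B"
  shows "hermitian_mat n (A - B)"
  using hermitian_matD[OF assms(1)] hermitian_matD[OF assms(2)]
  by (intro hermitian_matI) auto

lemma loewner_le_iff_quad_form:
  assumes "hermitian_mat n A" "hermitian_mat n B"
  shows "loewner_le n A B \<longleftrightarrow> (\<forall>v. Re (quad_form n A v) \<le> Re (quad_form n B v))"
  using assms hermitian_matD(1)[OF assms(1)] hermitian_matD(1)[OF assms(2)]
  by (simp add: loewner_le_def positive_mat_iff_quad_form hermitian_minus quad_form_minus)

lemma positive_sandwich:
  assumes W: "W \<in> carrier_mat n m" and c: "\<And>k. k < m \<Longrightarrow> 0 \<le> c k"
  shows "positive_mat n (W * mat_diag m (\<lambda>i. complex_of_real (c i)) * mat_adjoint W)"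
  unfolding positive_mat_iff_quad_form quad_form_sandwich[OF W] Re_sum
  using c by (auto intro!: sum_nonneg hermitian_sandwich[OF W] simp flip: of_real_mult)

lemma hermitian_mat_fun:
  assumes "hermitian_mat n A"
  shows "hermitian_mat n (mat_fun f A)"
proof -
  obtain U d where S: "spectral_form n A U d" using hermitian_spectral_form[OF assms] by blast
  then have "U \<in> carrier_mat n n" by (auto simp: spectral_form_def unitary_mat_def)
  then show ?thesis unfolding mat_fun_spectral_form[OF S] by (rule hermitian_sandwich)
qed

lemma spectrum_positive_mat:
  assumes "positive_mat n A"
  shows "spectrum A \<subseteq> complex_of_real ` {0..}"
proof
  fix e assume "e \<in> spectrum A"
  then have "e \<in> \<real>" "0 \<le> Re e" using assms by (auto simp: spectrum_def positive_mat_def)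
  then show "e \<in> complex_of_real ` {0..}" by (auto elim!: Reals_cases)
qed

section \<open>The operator Jensen inequality\<close>

text \<open>The Halmos dilation: if \<open>W W* = 1\<close>, then \<open>1 - W* W\<close> is an orthogonal projection, and this
  makes \<open>W\<close> the corner of an explicit unitary matrix.\<close>

lemma halmos_dilation_unitary:
  fixes W :: "complex mat"
  assumes W: "W \<in> carrier_mat p N" "W * mat_adjoint W = 1\<^sub>m p"
  shows "unitary_mat (p + N)
    (four_block_mat W (0\<^sub>m p p) (1\<^sub>m N - mat_adjoint W * W) (mat_adjoint W))"
proof (rule unitary_matI)
  let ?P = "mat_adjoint W * W"
  let ?Q = "1\<^sub>m N - ?P"
  have a: "mat_adjoint W \<in> carrier_mat N p" using W(1) by auto
  have P: "?P \<in> carrier_mat N N" using W(1) a by auto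
  then have Q: "?Q \<in> carrier_mat N N" by (rule minus_carrier_mat)
  have z: "mat_adjoint (0\<^sub>m a b :: complex mat) = 0\<^sub>m b a" for a b by (rule eq_matI) auto
  have Pa: "mat_adjoint ?P = ?P" using mat_adjoint_mult[OF a W(1)] by simp
  have Qa: "mat_adjoint ?Q = ?Q"
    using hermitian_minus[of N "1\<^sub>m N" ?P] P Pa by (auto simp: hermitian_mat_def)
  have PP: "?P * ?P = ?P"
  proof -
    have "?P * ?P = mat_adjoint W * (W * ?P)" using W(1) a P by (intro assoc_mult_mat[of _ N p _ N _ N]) auto
    also have "W * ?P = W * mat_adjoint W * W" using W(1) a by (intro assoc_mult_mat[of _ p N _ p _ N, symmetric]) auto
    finally show ?thesis using W by simp
  qed
  have WP: "W * ?P = W"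
  proof -
    have "W * ?P = W * mat_adjoint W * W" using W(1) a by (intro assoc_mult_mat[of _ p N _ p _ N, symmetric]) auto
    then show ?thesis using W by simp
  qed
  have PW: "?P * mat_adjoint W = mat_adjoint W"
    using W a assoc_mult_mat[of "mat_adjoint W" N p W N "mat_adjoint W" p] by simp
  have WQ: "W * ?Q = 0\<^sub>m p N"
    using mult_minus_distrib_mat[OF W(1) one_carrier_mat P] WP W(1) by simp
  have QW: "?Q * mat_adjoint W = 0\<^sub>m N p"
    using minus_mult_distrib_mat[OF one_carrier_mat P a] PW a left_mult_one_mat[OF a] by simp
  have QQ: "?Q * ?Q = ?Q"
  proof -
    have "?Q * ?Q = ?Q * 1\<^sub>m N - ?Q * ?P" by (rule mult_minus_distrib_mat[OF Q one_carrier_mat P])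
    also have "?Q * ?P = 1\<^sub>m N * ?P - ?P * ?P" by (rule minus_mult_distrib_mat[OF one_carrier_mat P P])
    also have "\<dots> = 0\<^sub>m N N" using P by (simp add: PP left_mult_one_mat[OF P])
    also have "?Q * 1\<^sub>m N - 0\<^sub>m N N = ?Q"
      unfolding right_mult_one_mat[OF Q] using P by (intro eq_matI) auto
    finally show ?thesis .
  qed
  have QPI: "?Q + ?P = 1\<^sub>m N" using P by (intro eq_matI) auto
  let ?U = "four_block_mat W (0\<^sub>m p p) ?Q (mat_adjoint W)"
  show "?U \<in> carrier_mat (p + N) (p + N)"
    using W(1) a by (metis add.commute four_block_carrier_mat)
  have Ua: "mat_adjoint ?U = four_block_mat (mat_adjoint W) ?Q (0\<^sub>m p p) W"
    unfolding mat_adjoint_four_block[OF W(1) zero_carrier_mat Q a] z Qa by simp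
  show "?U * mat_adjoint ?U = 1\<^sub>m (p + N)"
    unfolding Ua mult_four_block_mat[OF W(1) zero_carrier_mat Q a a Q zero_carrier_mat W(1)]
      W(2) WQ QW QQ QPI
    using W(1) a by (simp add: left_mult_zero_mat[of _ p] right_mult_zero_mat[of _ N p])
qed

text \<open>The operator Jensen inequality of Hansen and Pedersen for diagonal matrices.
  Dilate \<open>W\<close> to a unitary \<open>U\<close>. Then \<open>A = W D W*\<close> is the upper left corner of the positive matrix
  \<open>M = U (D \<oplus> 0) U*\<close>, and \<open>W f(D) W*\<close> is the upper left corner of \<open>f(M)\<close>. With the reflection
  \<open>S = 1 \<oplus> (-1)\<close>, the mean of \<open>M\<close> and \<open>S M S\<close> is the block diagonal part \<open>A \<oplus> B\<close> of \<open>M\<close>. Midpoint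
  convexity compares \<open>f(A \<oplus> B) = f(A) \<oplus> f(B)\<close> with the mean of \<open>f(M)\<close> and \<open>S f(M) S\<close>, which has the
  same upper left corner as \<open>f(M)\<close>.\<close>

lemma matrix_convex_jensen:
  assumes f: "matrix_convex_on {0..} f"
    and W: "W \<in> carrier_mat p N" "W * mat_adjoint W = 1\<^sub>m p"
    and x: "\<And>k. k < N \<Longrightarrow> 0 \<le> x k"
  shows "loewner_le p
    (mat_fun f (W * mat_diag N (\<lambda>k. complex_of_real (x k)) * mat_adjoint W))
    (W * mat_diag N (\<lambda>k. complex_of_real (f (x k))) * mat_adjoint W)"
proof -
  let ?n = "p + N"
  define U where "U = four_block_mat W (0\<^sub>m p p) (1\<^sub>m N - mat_adjoint W * W) (mat_adjoint W)"
  \<comment> \<open>The \<open>p\<close> additional diagonal entries must lie in the domain of \<open>f\<close>; their value does not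
    reach the corner, since the upper right block of \<open>U\<close> vanishes.\<close>
  define d where "d k = (if k < N then x k else 0)" for k
  define s where "s i = (if i < p then 1 else -1 :: real)" for i
  define S where "S = mat_diag ?n (\<lambda>i. complex_of_real (s i))"
  define sand where "sand g = U * mat_diag ?n (\<lambda>i. complex_of_real (g (d i))) * mat_adjoint U" for g :: "real \<Rightarrow> real"
  define M where "M = sand (\<lambda>x. x)"
  define R where "R = S * M * mat_adjoint S"
  define A where "A = W * mat_diag N (\<lambda>k. complex_of_real (x k)) * mat_adjoint W"
  define B where "B = mat N N (\<lambda>(i,j). M $$ (i + p, j + p))"
  have U: "unitary_mat ?n U" unfolding U_def by (rule halmos_dilation_unitary[OF W])
  then have Uc: "U \<in> carrier_mat ?n ?n" by (auto simp: unitary_mat_def)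
  have Sc: "S \<in> carrier_mat ?n ?n" by (simp add: S_def)
  have Sa: "mat_adjoint S = S" unfolding S_def by (rule mat_adjoint_real_diag)
  have S: "unitary_mat ?n S"
  proof (rule unitary_matI[OF Sc])
    show "S * mat_adjoint S = 1\<^sub>m ?n"
      unfolding Sa unfolding S_def mat_diag_diag
      by (rule eq_matI) (auto simp: mat_diag_def s_def)
  qed
  have M: "spectral_form ?n M U d" using U by (simp add: spectral_form_def M_def sand_def)
  have R: "spectral_form ?n R (S * U) d" unfolding R_def by (rule spectral_form_conj[OF S M])
  have Mh: "hermitian_mat ?n M" and Rh: "hermitian_mat ?n R"
    using M R spectral_form_hermitian by blast+
  have Mc: "M \<in> carrier_mat ?n ?n" and Rc: "R \<in> carrier_mat ?n ?n"
    using M R spectral_form_carrier by blast+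
  have pos: "positive_mat ?n M" "positive_mat ?n R"
  proof -
    show "positive_mat ?n M" unfolding M_def sand_def
      by (rule positive_sandwich[OF Uc]) (auto simp: d_def x)
    show "positive_mat ?n R" using R mult_carrier_mat[OF Sc Uc] unfolding spectral_form_def
      by (metis (no_types, lifting) R_def d_def order_refl positive_sandwich x)
  qed
  have Sx: "(S * X * mat_adjoint S) $$ (i,j) = s i * s j * X $$ (i,j)"
    if "X \<in> carrier_mat ?n ?n" "i < ?n" "j < ?n" for X i j
    unfolding Sa unfolding S_def using that
    by (simp add: mat_diag_mult_left[OF that(1)] mat_diag_mult_right[of _ ?n])
  have corner: "sand g $$ (i,j) = (W * mat_diag N (\<lambda>k. complex_of_real (g (x k))) * mat_adjoint W) $$ (i,j)"
    if "i < p" "j < p" for g i j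
  proof -
    have "sand g $$ (i,j) = (\<Sum>k<?n. U $$ (i,k) * g (d k) * cnj (U $$ (j,k)))"
      unfolding sand_def using that by (intro sandwich_index[OF Uc]) auto
    also have "\<dots> = (\<Sum>k<N. U $$ (i,k) * g (d k) * cnj (U $$ (j,k)))"
      using that W(1) by (intro sum.mono_neutral_right) (auto simp: U_def)
    also have "\<dots> = (\<Sum>k<N. W $$ (i,k) * g (x k) * cnj (W $$ (j,k)))"
      using that W(1) by (intro sum.cong) (auto simp: U_def d_def)
    finally show ?thesis using that by (simp add: sandwich_index[OF W(1)])
  qed
  have Ah: "hermitian_mat p A" unfolding A_def by (rule hermitian_sandwich[OF W(1)])
  then obtain UA dA where SA: "spectral_form p A UA dA" using hermitian_spectral_form by blast
  have Bh: "hermitian_mat N B"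
    by (rule hermitian_matI) (auto simp: B_def hermitian_matD(3)[OF Mh])
  then obtain UB dB where SB: "spectral_form N B UB dB" using hermitian_spectral_form by blast
  let ?A = "four_block_mat A (0\<^sub>m p N) (0\<^sub>m N p) B"
  \<comment> \<open>Averaging with the reflection \<open>S\<close> kills the off-diagonal blocks.\<close>
  have pinch: "(1/2) \<cdot>\<^sub>m (M + R) = ?A"
  proof (rule eq_matI)
    fix i j assume "i < dim_row ?A" "j < dim_col ?A"
    then have ij: "i < ?n" "j < ?n" using hermitian_matD(1)[OF Ah] by (auto simp: B_def)
    have Rij: "R $$ (i,j) = s i * s j * M $$ (i,j)" unfolding R_def by (rule Sx[OF Mc ij])
    have "((1/2) \<cdot>\<^sub>m (M + R)) $$ (i,j) = (M $$ (i,j) + R $$ (i,j)) / 2"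
      using ij Mc Rc by simp
    also have "\<dots> = (1 + s i * s j) / 2 * M $$ (i,j)"
      by (simp add: Rij field_simps)
    also have "\<dots> = ?A $$ (i,j)"
      using ij hermitian_matD(1)[OF Ah] by (auto simp: s_def B_def M_def corner A_def)
    finally show "((1/2) \<cdot>\<^sub>m (M + R)) $$ (i,j) = ?A $$ (i,j)" .
  qed (use Mc Rc hermitian_matD(1)[OF Ah] in \<open>auto simp: B_def\<close>)
  have fM: "mat_fun f M = sand f" unfolding sand_def by (rule mat_fun_spectral_form[OF M])
  have sandc: "sand g \<in> carrier_mat ?n ?n" for g using Uc by (simp add: sand_def)
  have fR: "mat_fun f R = S * sand f * mat_adjoint S"
    unfolding mat_fun_spectral_form[OF R] sand_def mat_adjoint_mult[OF Sc Uc]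
    using Uc Sc mat_adjoint_carrier[OF Uc] mat_adjoint_carrier[OF Sc]
    by (simp add: assoc_mult_mat[of _ ?n ?n _ ?n _ ?n] mult_carrier_mat[of _ ?n ?n _ ?n])
  have fR': "S * mat_fun f M * mat_adjoint S = mat_fun f R" by (simp add: fM fR)
  have fA: "mat_fun f ?A = four_block_mat (mat_fun f A) (0\<^sub>m p N) (0\<^sub>m N p) (mat_fun f B)"
  proof -
    let ?c = "\<lambda>d i. complex_of_real (f (d i))"
    have cA: "UA \<in> carrier_mat p p" "unitary_mat p UA" and cB: "UB \<in> carrier_mat N N" "unitary_mat N UB"
      using SA SB by (auto simp: spectral_form_def unitary_mat_def)
    have "spectral_form p (mat_fun f A) UA (\<lambda>i. f (dA i))" "spectral_form N (mat_fun f B) UB (\<lambda>i. f (dB i))"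
      using cA cB by (auto simp: spectral_form_def mat_fun_spectral_form[OF SA] mat_fun_spectral_form[OF SB])
    from spectral_form_block[OF this] show ?thesis
      unfolding mat_fun_spectral_form[OF spectral_form_block[OF SA SB]] spectral_form_def
      by (simp add: if_distrib[of f])
  qed
  have "loewner_le ?n (mat_fun f ?A) ((1/2) \<cdot>\<^sub>m (sand f + S * sand f * mat_adjoint S))"
    unfolding pinch[symmetric] fM[symmetric] fR'
    using f Mh Rh spectrum_positive_mat[OF pos(1)] spectrum_positive_mat[OF pos(2)]
    by (simp add: matrix_convex_on_def)
  then have "0 \<le> Re (quad_form ?n ((1/2) \<cdot>\<^sub>m (sand f + S * sand f * mat_adjoint S) - mat_fun f ?A) v)" for v
    by (simp add: loewner_le_def positive_mat_iff_quad_form)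
  \<comment> \<open>Vectors supported on the first block see the upper left corners only.\<close>
  moreover have "quad_form ?n ((1/2) \<cdot>\<^sub>m (sand f + S * sand f * mat_adjoint S) - mat_fun f ?A)
        (\<lambda>i. if i < p then v i else 0) =
      quad_form p (W * mat_diag N (\<lambda>k. complex_of_real (f (x k))) * mat_adjoint W - mat_fun f A) v" for v
  proof -
    let ?X = "(1/2) \<cdot>\<^sub>m (sand f + S * sand f * mat_adjoint S) - mat_fun f ?A"
    let ?Y = "W * mat_diag N (\<lambda>k. complex_of_real (f (x k))) * mat_adjoint W - mat_fun f A"
    have c: "mat_fun f A \<in> carrier_mat p p" "mat_fun f B \<in> carrier_mat N N"
      using hermitian_mat_fun Ah Bh hermitian_matD(1) by blast+
    have XY: "?X $$ (i,j) = ?Y $$ (i,j)" if "i < p" "j < p" for i j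
    proof -
      have ij: "i < ?n" "j < ?n" using that by auto
      have "?X $$ (i,j) = (1/2) * (sand f $$ (i,j) + (S * sand f * mat_adjoint S) $$ (i,j)) - mat_fun f A $$ (i,j)"
        using ij that c sandc[of f] Sc by (simp add: fA)
      also have "\<dots> = ?Y $$ (i,j)"
        unfolding Sx[OF sandc ij] corner[OF that] using that W(1) c by (simp add: s_def)
      finally show ?thesis .
    qed
    have "quad_form ?n ?X (\<lambda>i. if i < p then v i else 0) =
        (\<Sum>i<p. \<Sum>j<?n. cnj (v i) * ?X $$ (i,j) * (if j < p then v j else 0))"
      unfolding quad_form_def by (intro sum.mono_neutral_cong_right) auto
    also have "\<dots> = (\<Sum>i<p. \<Sum>j<p. cnj (v i) * ?Y $$ (i,j) * v j)"
      by (intro sum.cong refl sum.mono_neutral_cong_right) (auto simp: XY)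
    finally show ?thesis unfolding quad_form_def .
  qed
  ultimately have "0 \<le> Re (quad_form p (W * mat_diag N (\<lambda>k. complex_of_real (f (x k))) * mat_adjoint W - mat_fun f A) v)" for v
    by metis
  moreover have h: "hermitian_mat p (mat_fun f A)"
    "hermitian_mat p (W * mat_diag N (\<lambda>k. complex_of_real (f (x k))) * mat_adjoint W)"
    using hermitian_mat_fun[OF Ah] hermitian_sandwich[OF W(1)] by auto
  ultimately show ?thesis
    unfolding A_def[symmetric] loewner_le_def positive_mat_iff_quad_form
    using hermitian_minus hermitian_matD(1) by blast
qed

section \<open>Positive multilinear maps as compressions of diagonal matrices\<close>

lemma mat_fun_id:
  assumes "hermitian_mat n A"
  shows "mat_fun (\<lambda>x. x) A = A"
proof -
  obtain U d where S: "spectral_form n A U d" using hermitian_spectral_form[OF assms] by blast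
  then show ?thesis by (simp add: mat_fun_spectral_form[OF S]) (simp add: spectral_form_def)
qed

lemma mat_fun_one:
  assumes "hermitian_mat n A"
  shows "mat_fun (\<lambda>x. 1) A = 1\<^sub>m n"
proof -
  obtain U d where S: "spectral_form n A U d" using hermitian_spectral_form[OF assms] by blast
  then show ?thesis
    by (simp add: mat_fun_spectral_form[OF S]) (auto simp: spectral_form_def unitary_mat_def)
qed

lemma quad_form_mat_fun_uminus:
  assumes "hermitian_mat n A"
  shows "quad_form n (mat_fun (\<lambda>x. - f x) A) v = - quad_form n (mat_fun f A) v"
proof -
  obtain U d where S: "spectral_form n A U d" using hermitian_spectral_form[OF assms] by blast
  then have "U \<in> carrier_mat n n" by (auto simp: spectral_form_def unitary_mat_def)
  then show ?thesis by (simp add: mat_fun_spectral_form[OF S] quad_form_sandwich sum_negf)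
qed

lemma multilinear_mapD:
  assumes "multilinear_map k q p \<Phi>" "As \<in> mat_tuples k q"
  shows "\<Phi> As \<in> carrier_mat p p"
    "i < k \<Longrightarrow> B \<in> carrier_mat q q \<Longrightarrow> C \<in> carrier_mat q q \<Longrightarrow>
      \<Phi> (As[i := B + C]) = \<Phi> (As[i := B]) + \<Phi> (As[i := C])"
    "i < k \<Longrightarrow> B \<in> carrier_mat q q \<Longrightarrow> \<Phi> (As[i := c \<cdot>\<^sub>m B]) = c \<cdot>\<^sub>m \<Phi> (As[i := B])"
  using assms unfolding multilinear_map_def by simp_all

lemma multilinear_sum_first:
  fixes n :: nat
  assumes ml: "multilinear_map (Suc k) q p \<Phi>" and Bs: "Bs \<in> mat_tuples k q"
    and P: "\<And>j. j < n \<Longrightarrow> P j \<in> carrier_mat q q" and ab: "a < p" "b < p"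
  shows "\<Phi> (mat q q (\<lambda>(a,b). \<Sum>j<n. c j * P j $$ (a,b)) # Bs) $$ (a,b) =
    (\<Sum>j<n. c j * \<Phi> (P j # Bs) $$ (a,b))"
proof -
  have car: "\<Phi> (X # Bs) \<in> carrier_mat p p" if "X \<in> carrier_mat q q" for X
    using ml Bs that unfolding multilinear_map_def mat_tuples_def by auto
  have add: "\<Phi> ((X + Y) # Bs) = \<Phi> (X # Bs) + \<Phi> (Y # Bs)"
    if "X \<in> carrier_mat q q" "Y \<in> carrier_mat q q" for X Y
  proof -
    have "X # Bs \<in> mat_tuples (Suc k) q" using that Bs by (auto simp: mat_tuples_def)
    from multilinear_mapD(2)[OF ml this zero_less_Suc that]
    show ?thesis by simp
  qed
  have scale: "\<Phi> ((z \<cdot>\<^sub>m X) # Bs) = z \<cdot>\<^sub>m \<Phi> (X # Bs)" if "X \<in> carrier_mat q q" for X z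
  proof -
    have "X # Bs \<in> mat_tuples (Suc k) q" using that Bs by (auto simp: mat_tuples_def)
    from multilinear_mapD(3)[OF ml this zero_less_Suc that]
    show ?thesis by simp
  qed
  show ?thesis using P
  proof (induction n)
    case 0
    have z: "mat q q (\<lambda>(a,b). \<Sum>j<0. c j * P j $$ (a,b)) = 0 \<cdot>\<^sub>m 0\<^sub>m q q"
      by (rule eq_matI) auto
    show ?case
      unfolding z scale[OF zero_carrier_mat] using car[OF zero_carrier_mat] ab by simp
  next
    case (Suc n)
    let ?S = "mat q q (\<lambda>(a,b). \<Sum>j<n. c j * P j $$ (a,b))"
    have Pn: "P n \<in> carrier_mat q q" using Suc.prems by simp
    have s: "mat q q (\<lambda>(a,b). \<Sum>j<Suc n. c j * P j $$ (a,b)) = ?S + c n \<cdot>\<^sub>m P n"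
      using Pn by (intro eq_matI) auto
    have "\<Phi> (?S # Bs) $$ (a,b) = (\<Sum>j<n. c j * \<Phi> (P j # Bs) $$ (a,b))"
      by (rule Suc.IH) (use Suc.prems in simp)
    then show ?case unfolding s using Pn car[of ?S] car[OF Pn] ab by (simp add: add scale)
  qed
qed

lemma sum_list_concat_upt:
  fixes h :: "'a \<Rightarrow> complex"
  shows "(\<Sum>y\<leftarrow>concat (map F [0..<n]). h y) = (\<Sum>j<n. \<Sum>y\<leftarrow>F j. h y)"
  by (induction n) (auto simp: add.commute)

text \<open>Expand every argument in its rank one spectral projections and every resulting positive value
  of \<open>\<Phi>\<close> in rank one matrices \<open>u u*\<close>. An entry \<open>(xs, u)\<close> of the list records one eigenvalue of each
  argument together with the vector \<open>u\<close>. The point is that the same list serves all functions \<open>g\<close>: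
  the identity, the constant 1 and \<open>f\<close> give the three values of \<open>\<Phi>\<close> that occur in the inequality.
  The induction fixes the first argument to be one of its projections, which leaves a positive
  multilinear map in fewer variables.\<close>

lemma multilinear_spectral_decomposition:
  assumes "multilinear_map k q p \<Phi>" "positive_map k q p \<Phi>"
    and "As \<in> mat_tuples k q" "\<forall>A \<in> set As. positive_mat q A"
  shows "\<exists>L :: (real list \<times> (nat \<Rightarrow> complex)) list.
     (\<forall>(xs,u) \<in> set L. length xs = k \<and> (\<forall>x \<in> set xs. 0 \<le> x)) \<and>
     (\<forall>g a b. a < p \<longrightarrow> b < p \<longrightarrow> \<Phi> (map (mat_fun g) As) $$ (a,b) =
        (\<Sum>(xs,u)\<leftarrow>L. complex_of_real (prod_list (map g xs)) * u a * cnj (u b)))"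
  using assms
proof (induction k arbitrary: \<Phi> As)
  case 0
  then have As: "As = []" by (simp add: mat_tuples_def)
  with 0 have pos: "positive_mat p (\<Phi> [])" unfolding positive_map_def by auto
  then obtain U d where S: "spectral_form p (\<Phi> []) U d"
    using hermitian_spectral_form unfolding positive_mat_def by blast
  then have U: "U \<in> carrier_mat p p"
    and eq: "\<Phi> [] = U * mat_diag p (\<lambda>i. complex_of_real (d i)) * mat_adjoint U"
    by (auto simp: spectral_form_def unitary_mat_def)
  \<comment> \<open>The value on the empty tuple is a positive matrix, hence a sum of rank one matrices.\<close>
  define L where "L = map (\<lambda>l. ([] :: real list, \<lambda>a. U $$ (a,l) * complex_of_real (sqrt (d l)))) [0..<p]"
  have "\<Phi> [] $$ (a,b) = (\<Sum>(xs,u)\<leftarrow>L. complex_of_real (prod_list (map g xs)) * u a * cnj (u b))"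
    if "a < p" "b < p" for g :: "real \<Rightarrow> real" and a b
  proof -
    have sq: "of_real (sqrt (d l)) * of_real (sqrt (d l)) = complex_of_real (d l)" if "l < p" for l
      using spectral_form_nonneg[OF pos S that] by (simp flip: of_real_mult)
    have "\<Phi> [] $$ (a,b) = (\<Sum>l<p. U $$ (a,l) * complex_of_real (d l) * cnj (U $$ (b,l)))"
      unfolding eq by (rule sandwich_index[OF U that])
    also have "\<dots> = (\<Sum>l<p. (U $$ (a,l) * of_real (sqrt (d l))) * cnj (U $$ (b,l) * of_real (sqrt (d l))))"
      by (intro sum.cong refl) (simp add: mult_ac flip: sq)
    finally show ?thesis
      by (simp add: L_def o_def interv_sum_list_conv_sum_set_nat atLeast0LessThan)
  qed
  then have "(\<forall>(xs,u) \<in> set L. length xs = 0 \<and> (\<forall>x \<in> set xs. 0 \<le> x)) \<and>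
     (\<forall>g a b. a < p \<longrightarrow> b < p \<longrightarrow> \<Phi> (map (mat_fun g) As) $$ (a,b) =
        (\<Sum>(xs,u)\<leftarrow>L. complex_of_real (prod_list (map g xs)) * u a * cnj (u b)))"
    by (auto simp: As) (auto simp: L_def)
  then show ?case by blast
next
  case (Suc k)
  then obtain A Bs where As: "As = A # Bs" and A: "positive_mat q A"
    and Bs: "Bs \<in> mat_tuples k q" "\<forall>B \<in> set Bs. positive_mat q B"
    by (cases As) (auto simp: mat_tuples_def)
  obtain U d where S: "spectral_form q A U d"
    using hermitian_spectral_form A unfolding positive_mat_def by blast
  then have U: "U \<in> carrier_mat q q" by (auto simp: spectral_form_def unitary_mat_def)
  \<comment> \<open>The rank one spectral projections of the first argument.\<close>
  define P where "P j = U * mat_diag q (\<lambda>i. complex_of_real (if i = j then 1 else 0)) * mat_adjoint U" for j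
  have P: "positive_mat q (P j)" and Pc: "P j \<in> carrier_mat q q" for j
    unfolding P_def using U by (auto intro!: positive_sandwich)
  have Pab: "P j $$ (a,b) = U $$ (a,j) * cnj (U $$ (b,j))" if "j < q" "a < q" "b < q" for j a b
    unfolding P_def sandwich_index[OF U that(2,3)] using that
    by (simp add: if_distrib[of "\<lambda>x. _ * x"] if_distrib[of "\<lambda>x. x * _"] if_distrib[of complex_of_real] cong: if_cong)
  have fA: "mat_fun g A = mat q q (\<lambda>(a,b). \<Sum>j<q. complex_of_real (g (d j)) * P j $$ (a,b))" for g
    unfolding mat_fun_spectral_form[OF S] using U
    by (intro eq_matI) (auto simp: sandwich_index[OF U] Pab mult_ac simp del: index_mult_mat(1) intro!: sum.cong)
  define good :: "nat \<Rightarrow> (real list \<times> (nat \<Rightarrow> complex)) list \<Rightarrow> bool" where "good j L \<longleftrightarrow>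
     (\<forall>(xs,u) \<in> set L. length xs = k \<and> (\<forall>x \<in> set xs. 0 \<le> x)) \<and>
     (\<forall>g a b. a < p \<longrightarrow> b < p \<longrightarrow> \<Phi> (P j # map (mat_fun g) Bs) $$ (a,b) =
        (\<Sum>(xs,u)\<leftarrow>L. complex_of_real (prod_list (map g xs)) * u a * cnj (u b)))" for j L
  have "\<exists>L. good j L" for j
    unfolding good_def
  proof (rule Suc.IH[of "\<lambda>Bs. \<Phi> (P j # Bs)", OF _ _ Bs])
    have tup: "P j # Cs \<in> mat_tuples (Suc k) q" if "Cs \<in> mat_tuples k q" for Cs
      using that Pc[of j] by (auto simp: mat_tuples_def)
    have upd: "P j # Cs[i := X] = (P j # Cs)[Suc i := X]" for Cs i X by simp
    show "multilinear_map k q p (\<lambda>Bs. \<Phi> (P j # Bs))"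
      unfolding multilinear_map_def upd
    proof (intro conjI ballI allI impI)
      fix Cs assume Cs: "Cs \<in> mat_tuples k q"
      note D = multilinear_mapD[OF Suc.prems(1) tup[OF Cs]]
      show "\<Phi> (P j # Cs) \<in> carrier_mat p p" by (rule D(1))
      fix i and B :: "complex mat" assume i: "i < k" and B: "B \<in> carrier_mat q q"
      show "\<Phi> ((P j # Cs)[Suc i := B + C]) = \<Phi> ((P j # Cs)[Suc i := B]) + \<Phi> ((P j # Cs)[Suc i := C])"
        if "C \<in> carrier_mat q q" for C
        using i B that by (intro D(2)) auto
      show "\<Phi> ((P j # Cs)[Suc i := c \<cdot>\<^sub>m B]) = c \<cdot>\<^sub>m \<Phi> ((P j # Cs)[Suc i := B])" for c
        using i B by (intro D(3)) auto
    qed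
    show "positive_map k q p (\<lambda>Bs. \<Phi> (P j # Bs))"
      using Suc.prems(2) tup P[of j] unfolding positive_map_def by simp
  qed
  then obtain L where L: "\<And>j. good j (L j)" by metis
  have L1: "length xs = k \<and> (\<forall>x \<in> set xs. 0 \<le> x)" if "(xs,u) \<in> set (L j)" for j xs u
    using L[of j] that unfolding good_def by blast
  have L2: "\<Phi> (P j # map (mat_fun g) Bs) $$ (a,b) =
        (\<Sum>(xs,u)\<leftarrow>L j. complex_of_real (prod_list (map g xs)) * u a * cnj (u b))"
    if "a < p" "b < p" for j g a b
    using L[of j] that unfolding good_def by blast
  define M where "M = concat (map (\<lambda>j. map (\<lambda>(xs,u). (d j # xs, u)) (L j)) [0..<q])"
  have "length xs = Suc k \<and> (\<forall>x \<in> set xs. 0 \<le> x)" if "(xs,u) \<in> set M" for xs u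
    using that L1 spectral_form_nonneg[OF A S] by (fastforce simp: M_def)
  moreover have "\<Phi> (map (mat_fun g) As) $$ (a,b) =
        (\<Sum>(xs,u)\<leftarrow>M. complex_of_real (prod_list (map g xs)) * u a * cnj (u b))"
    if "a < p" "b < p" for g a b
  proof -
    have Bg: "map (mat_fun g) Bs \<in> mat_tuples k q"
      using Bs hermitian_mat_fun hermitian_matD(1) unfolding mat_tuples_def positive_mat_def by auto
    have "\<Phi> (map (mat_fun g) As) $$ (a,b) =
        (\<Sum>j<q. complex_of_real (g (d j)) * \<Phi> (P j # map (mat_fun g) Bs) $$ (a,b))"
      unfolding As list.map fA by (rule multilinear_sum_first[OF Suc.prems(1) Bg Pc that])
    also have "\<dots> = (\<Sum>j<q. \<Sum>(xs,u)\<leftarrow>L j. complex_of_real (prod_list (map g (d j # xs))) * u a * cnj (u b))"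
      by (simp add: L2[OF that] sum_list_const_mult[symmetric] case_prod_unfold mult.assoc)
    also have "\<dots> = (\<Sum>(xs,u)\<leftarrow>M. complex_of_real (prod_list (map g xs)) * u a * cnj (u b))"
      unfolding M_def sum_list_concat_upt by (simp add: o_def case_prod_unfold)
    finally show ?thesis .
  qed
  ultimately show ?case by blast
qed

text \<open>The vectors \<open>u\<close> of the decomposition become the columns of \<open>W\<close>. This is a Naimark
  dilation of the resolution of the identity that \<open>\<Phi>\<close> assigns to the tuples of spectral projections.\<close>

lemma unital_multilinear_compression:
  assumes ml: "multilinear_map k q p \<Phi>" and "positive_map k q p \<Phi>" and un: "unital_map k q p \<Phi>"
    and As: "As \<in> mat_tuples k q" and pos: "\<forall>A \<in> set As. positive_mat q A"
  obtains N W xs where "W \<in> carrier_mat p N" "W * mat_adjoint W = 1\<^sub>m p"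
    "\<And>r. r < N \<Longrightarrow> length (xs r) = k" "\<And>r x. r < N \<Longrightarrow> x \<in> set (xs r) \<Longrightarrow> 0 \<le> x"
    "\<And>g. \<Phi> (map (mat_fun g) As) =
       W * mat_diag N (\<lambda>r. complex_of_real (prod_list (map g (xs r)))) * mat_adjoint W"
proof -
  obtain L :: "(real list \<times> (nat \<Rightarrow> complex)) list" where
    L1: "\<And>xs u. (xs,u) \<in> set L \<Longrightarrow> length xs = k \<and> (\<forall>x \<in> set xs. 0 \<le> x)" and
    L2: "\<And>g a b. a < p \<Longrightarrow> b < p \<Longrightarrow> \<Phi> (map (mat_fun g) As) $$ (a,b) =
        (\<Sum>(xs,u)\<leftarrow>L. complex_of_real (prod_list (map g xs)) * u a * cnj (u b))"
    using multilinear_spectral_decomposition[OF ml assms(2) As pos] by blast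
  define N where "N = length L"
  define W where "W = mat p N (\<lambda>(a,r). snd (L ! r) a)"
  define xs where "xs r = fst (L ! r)" for r
  have W: "W \<in> carrier_mat p N" by (simp add: W_def)
  have h: "hermitian_mat q A" if "A \<in> set As" for A using that pos by (auto simp: positive_mat_def)
  have rep: "\<Phi> (map (mat_fun g) As) =
       W * mat_diag N (\<lambda>r. complex_of_real (prod_list (map g (xs r)))) * mat_adjoint W" for g
  proof (rule eq_matI)
    have "map (mat_fun g) As \<in> mat_tuples k q"
      using As hermitian_mat_fun[OF h] hermitian_matD(1) unfolding mat_tuples_def by auto
    then have c: "\<Phi> (map (mat_fun g) As) \<in> carrier_mat p p" using ml by (auto simp: multilinear_map_def)
    let ?R = "W * mat_diag N (\<lambda>r. complex_of_real (prod_list (map g (xs r)))) * mat_adjoint W"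
    show "dim_row (\<Phi> (map (mat_fun g) As)) = dim_row ?R" "dim_col (\<Phi> (map (mat_fun g) As)) = dim_col ?R"
      using c W by auto
    fix a b assume "a < dim_row ?R" "b < dim_col ?R"
    then have ab: "a < p" "b < p" using W by auto
    show "\<Phi> (map (mat_fun g) As) $$ (a,b) = ?R $$ (a,b)"
      unfolding L2[OF ab] sandwich_index[OF W ab] sum_list_sum_nth
      using ab by (auto simp: W_def xs_def N_def case_prod_unfold atLeast0LessThan mult_ac intro!: sum.cong)
  qed
  have "map (mat_fun (\<lambda>x. 1)) As = replicate k (1\<^sub>m q)"
    using As mat_fun_one[OF h] by (auto simp: mat_tuples_def intro!: replicate_eqI)
  \<comment> \<open>The constant function 1 turns unitality into the normalization of \<open>W\<close>.\<close>
  then have "W * mat_diag N (\<lambda>r. complex_of_real (prod_list (map (\<lambda>x. 1) (xs r)))) * mat_adjoint W = 1\<^sub>m p"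
    using rep[of "\<lambda>x. 1"] un by (simp add: unital_map_def)
  moreover have "prod_list (map (\<lambda>x. 1) ys) = (1::real)" for ys :: "real list" by (induction ys) auto
  ultimately have "W * mat_adjoint W = 1\<^sub>m p" using right_mult_one_mat[OF W] by simp
  moreover have "length (xs r) = k" "x \<in> set (xs r) \<Longrightarrow> 0 \<le> x" if "r < N" for r x
    using L1[of "fst (L ! r)" "snd (L ! r)"] that by (auto simp: N_def xs_def)
  ultimately show thesis using that W rep by blast
qed

section \<open>Products of several factors\<close>

text \<open>Ordinary convexity is the Jensen inequality for the row \<open>(sqrt t, sqrt (1 - t))\<close>.\<close>

lemma matrix_convex_scalar:
  assumes f: "matrix_convex_on {0..} f" and x: "0 \<le> x" "0 \<le> y" and t: "0 \<le> t" "t \<le> 1"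
  shows "f (t * x + (1 - t) * y) \<le> t * f x + (1 - t) * f y"
proof -
  define W where "W = mat 1 2 (\<lambda>(i,j). complex_of_real (sqrt (if j = 0 then t else 1 - t)))"
  have W: "W \<in> carrier_mat 1 2" by (simp add: W_def)
  have sq: "of_real (sqrt r) * of_real c * of_real (sqrt r) = complex_of_real (r * c)" if "0 \<le> r" for r c
    using that by (simp add: mult_ac flip: of_real_mult)
  have sand: "W * mat_diag 2 (\<lambda>k. complex_of_real (c k)) * mat_adjoint W =
      mat 1 1 (\<lambda>_. complex_of_real (t * c 0 + (1 - t) * c 1))" for c
  proof (rule eq_matI)
    fix i j assume "i < dim_row (mat 1 1 (\<lambda>_. complex_of_real (t * c 0 + (1 - t) * c 1)))"
      "j < dim_col (mat 1 1 (\<lambda>_. complex_of_real (t * c 0 + (1 - t) * c 1)))"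
    then have ij: "i = 0" "j = 0" by auto
    have "(W * mat_diag 2 (\<lambda>k. complex_of_real (c k)) * mat_adjoint W) $$ (i,j) =
       (\<Sum>k<2. W $$ (i,k) * complex_of_real (c k) * cnj (W $$ (j,k)))"
      using ij by (intro sandwich_index[OF W]) auto
    also have "\<dots> = of_real (sqrt t) * of_real (c 0) * of_real (sqrt t) +
       of_real (sqrt (1 - t)) * of_real (c 1) * of_real (sqrt (1 - t))"
      unfolding ij by (simp add: W_def numeral_2_eq_2)
    also have "\<dots> = of_real (t * c 0 + (1 - t) * c 1)"
      using t by (simp add: sq)
    finally show "(W * mat_diag 2 (\<lambda>k. complex_of_real (c k)) * mat_adjoint W) $$ (i,j) =
      mat 1 1 (\<lambda>_. complex_of_real (t * c 0 + (1 - t) * c 1)) $$ (i,j)" using ij by simp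
  qed (use W in auto)
  have "W * mat_diag 2 (\<lambda>k. complex_of_real 1) * mat_adjoint W = 1\<^sub>m 1"
    unfolding sand by (rule eq_matI) auto
  then have "W * mat_adjoint W = 1\<^sub>m 1" using right_mult_one_mat[OF W] by simp
  from matrix_convex_jensen[OF f W this, of "\<lambda>k. if k = 0 then x else y"]
  have J: "loewner_le 1 (mat_fun f (mat 1 1 (\<lambda>_. complex_of_real (t * x + (1 - t) * y))))
      (mat 1 1 (\<lambda>_. complex_of_real (t * f x + (1 - t) * f y)))"
    unfolding sand using x by simp
  have "spectral_form 1 (mat 1 1 (\<lambda>_. complex_of_real a)) (1\<^sub>m 1) (\<lambda>_. a)" for a
    unfolding spectral_form_def
  proof (intro conjI eq_matI)
    show "unitary_mat 1 (1\<^sub>m 1)" by (auto simp: unitary_mat_def)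
  qed (auto simp: mat_diag_def)
  from mat_fun_spectral_form[OF this]
  have "mat_fun f (mat 1 1 (\<lambda>_. complex_of_real a)) = mat 1 1 (\<lambda>_. complex_of_real (f a))" for a
    by (auto simp: mat_diag_def intro!: eq_matI)
  note mf = this
  have "positive_mat 1 (mat 1 1 (\<lambda>_. complex_of_real (t * f x + (1 - t) * f y)) -
      mat 1 1 (\<lambda>_. complex_of_real (f (t * x + (1 - t) * y))))" (is "positive_mat 1 ?M")
    using J unfolding loewner_le_def mf by blast
  then have "0 \<le> Re (quad_form 1 ?M (\<lambda>_. 1))" by (simp add: positive_mat_iff_quad_form)
  then show ?thesis by (simp add: quad_form_def)
qed

text \<open>A negative value forces \<open>f \<le> 0\<close> throughout. If \<open>f 1 \<le> 0\<close>, this follows from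
  \<open>f y \<le> f 1 * f y\<close>. Otherwise sub-multiplicativity gives \<open>f 1 = 1\<close> and \<open>f 0 \<le> 0\<close>, so that
  \<open>f x \<ge> x\<close> for \<open>x \<ge> 1\<close> by convexity. This excludes \<open>z \<ge> 1\<close>, and sub-multiplicativity at \<open>z\<close> and
  \<open>1 / z\<close> excludes \<open>0 < z < 1\<close>, at \<open>0\<close> and \<open>2\<close> it excludes \<open>z = 0\<close>.\<close>

lemma submultiplicative_nonpos:
  assumes f: "matrix_convex_on {0..} f" and sub: "sub_multiplicative_on {0..} f"
    and z: "0 \<le> z" "f z < 0" and y: "0 \<le> y"
  shows "f y \<le> 0"
proof -
  have sm: "f (a * b) \<le> f a * f b" if "0 \<le> a" "0 \<le> b" for a b
    using sub that by (simp add: sub_multiplicative_on_def)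
  have cv: "f (t * a + (1 - t) * b) \<le> t * f a + (1 - t) * f b" if "0 \<le> a" "0 \<le> b" "0 \<le> t" "t \<le> 1" for a b t
    by (rule matrix_convex_scalar[OF f that])
  show ?thesis
  proof (cases "f 1 \<le> 0")
    case True
    have "f y * (1 - f 1) \<le> 0" using sm[of 1 y] y by (simp add: algebra_simps)
    then show ?thesis using True by (auto simp: mult_le_0_iff)
  next
    case False
    have "f 1 \<le> f 1 * f 1" using sm[of 1 1] by simp
    then have "1 \<le> f 1" using False by simp
    moreover have "f z * (f 1 - 1) \<ge> 0" using sm[of 1 z] z by (simp add: algebra_simps)
    then have "f 1 \<le> 1" using z by (auto simp: zero_le_mult_iff)
    ultimately have f1: "f 1 = 1" by simp
    have f0: "f 0 \<le> 0"
    proof (rule ccontr)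
      assume "\<not> f 0 \<le> 0"
      then have "f 0 * f z < 0" using z by (simp add: mult_less_0_iff)
      then show False using sm[of 0 z] z \<open>\<not> f 0 \<le> 0\<close> by simp
    qed
    \<comment> \<open>Convexity between \<open>0\<close> and \<open>x\<close>, where \<open>f 0 \<le> 0\<close> and \<open>f 1 = 1\<close>.\<close>
    have big: "x \<le> f x" if "1 \<le> x" for x
    proof -
      have "1 \<le> (1 / x) * f x + (1 - 1 / x) * f 0"
        using cv[of x 0 "1 / x"] that f1 by simp
      also have "\<dots> \<le> (1 / x) * f x + 0"
        using that f0 by (intro add_left_mono mult_nonneg_nonpos) auto
      finally show ?thesis using that by (simp add: field_simps)
    qed
    consider "z = 0" | "0 < z" "z < 1" | "1 \<le> z" using z by linarith
    then have False
    proof cases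
      case 1
      have "f 0 * (f 2 - 1) \<ge> 0" using sm[of 0 2] by (simp add: algebra_simps)
      then show False using big[of 2] z 1 by (auto simp: zero_le_mult_iff)
    next
      case 2
      have "1 \<le> f z * f (1 / z)" using sm[of z "1 / z"] 2 f1 by simp
      moreover have "f z * f (1 / z) \<le> 0" using z order.trans[OF _ big[of "1 / z"], of 0] 2 by (simp add: mult_le_0_iff)
      ultimately show False by simp
    next
      case 3
      then show False using big[of z] z by simp
    qed
    then show ?thesis ..
  qed
qed

lemma prod_list_nonneg: "\<forall>x \<in> set xs. 0 \<le> x \<Longrightarrow> 0 \<le> prod_list (xs :: real list)"
  by (induction xs) auto

lemma submultiplicative_prod_list_nonneg:
  assumes "sub_multiplicative_on {0..} f" "\<forall>x\<ge>0. 0 \<le> f x"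
  shows "xs \<noteq> [] \<Longrightarrow> \<forall>x \<in> set xs. 0 \<le> x \<Longrightarrow> f (prod_list xs) \<le> prod_list (map f xs)"
proof (induction xs rule: list_nonempty_induct)
  case (cons x xs)
  have "f (x * prod_list xs) \<le> f x * f (prod_list xs)"
    using assms(1) cons.prems prod_list_nonneg[of xs] by (auto simp: sub_multiplicative_on_def)
  also have "\<dots> \<le> f x * prod_list (map f xs)"
    using cons assms(2) by (intro mult_left_mono) auto
  finally show ?case by simp
qed auto

lemma supermultiplicative_nonneg:
  assumes "super_multiplicative_on {0..} f" "0 \<le> x"
  shows "0 \<le> f x"
proof -
  have "f (sqrt x) * f (sqrt x) \<le> f (sqrt x * sqrt x)"
    using assms(1)[unfolded super_multiplicative_on_def, THEN conjunct2, rule_format, of "sqrt x" "sqrt x"] assms(2)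
    by simp
  then show ?thesis using assms(2) by (smt (verit) real_sqrt_mult_self zero_le_square)
qed

lemma supermultiplicative_prod_list:
  assumes "super_multiplicative_on {0..} f"
  shows "xs \<noteq> [] \<Longrightarrow> \<forall>x \<in> set xs. 0 \<le> x \<Longrightarrow> prod_list (map f xs) \<le> f (prod_list xs)"
proof (induction xs rule: list_nonempty_induct)
  case (cons x xs)
  have "f x * prod_list (map f xs) \<le> f x * f (prod_list xs)"
    using cons supermultiplicative_nonneg[OF assms] by (intro mult_left_mono) auto
  also have "\<dots> \<le> f (x * prod_list xs)"
    using assms cons.prems prod_list_nonneg[of xs] by (auto simp: super_multiplicative_on_def)
  finally show ?case by simp
qed auto

lemma sign_prod_list_nonpos:
  "\<forall>x \<in> set xs. x \<le> 0 \<Longrightarrow> 0 \<le> (-1) ^ length xs * prod_list (xs :: real list)"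
proof (induction xs)
  case (Cons x xs)
  have "0 \<le> (- x) * ((-1) ^ length xs * prod_list xs)" by (rule mult_nonneg_nonneg) (use Cons in auto)
  also have "\<dots> = (-1) ^ length (x # xs) * prod_list (x # xs)" by simp
  finally show ?case .
qed auto

text \<open>For \<open>f \<ge> 0\<close> the two-factor inequality can be iterated. If \<open>f\<close> has a negative value, then
  \<open>f \<le> 0\<close> everywhere and the sign condition leaves a single factor, where equality holds, or an even
  number of factors, where the product on the right is nonnegative.\<close>

lemma submultiplicative_prod_list:
  assumes f: "matrix_convex_on {0..} f" and sub: "sub_multiplicative_on {0..} f"
    and sign: "sign_condition (length xs) f" and xs: "xs \<noteq> []" "\<forall>x \<in> set xs. 0 \<le> x"
  shows "f (prod_list xs) \<le> prod_list (map f xs)"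
proof (cases "\<forall>x\<ge>0. 0 \<le> f x")
  case True
  then show ?thesis by (rule submultiplicative_prod_list_nonneg[OF sub _ xs])
next
  case False
  then obtain z where z: "0 \<le> z" "f z < 0" by (auto simp: not_le)
  have np: "f y \<le> 0" if "0 \<le> y" for y by (rule submultiplicative_nonpos[OF f sub z that])
  show ?thesis
  proof (cases "length xs = 1")
    case True
    then show ?thesis by (auto simp: length_Suc_conv)
  next
    case l: False
    have "even (length xs)"
    proof (rule ccontr)
      assume "odd (length xs)"
      moreover from this have "3 \<le> length xs" using l by presburger
      ultimately show False using sign False by (auto simp: sign_condition_def)
    qed
    then have "0 \<le> prod_list (map f xs)"
      using sign_prod_list_nonpos[of "map f xs"] np xs by simp
    moreover have "f (prod_list xs) \<le> 0" using np prod_list_nonneg xs by blast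
    ultimately show ?thesis by simp
  qed
qed

section \<open>Jensen's inequality for unital positive multilinear maps\<close>

lemma quad_form_sandwich_mono:
  assumes "W \<in> carrier_mat n m" "\<And>k. k < m \<Longrightarrow> c k \<le> e k"
  shows "Re (quad_form n (W * mat_diag m (\<lambda>k. complex_of_real (c k)) * mat_adjoint W) v) \<le>
    Re (quad_form n (W * mat_diag m (\<lambda>k. complex_of_real (e k)) * mat_adjoint W) v)"
  unfolding quad_form_sandwich[OF assms(1)] Re_sum
  using assms(2) by (intro sum_mono) (auto intro!: mult_right_mono simp flip: of_real_mult)

theorem theorem3p2:
  fixes k p q :: nat
    and As :: "complex mat list"
    and \<Phi> :: "complex mat list \<Rightarrow> complex mat"
    and f :: "real \<Rightarrow> real"
  assumes "1 \<le> k" and "1 \<le> p" and "1 \<le> q"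
    and "As \<in> mat_tuples k q" and "\<forall>A \<in> set As. positive_mat q A"
    and "multilinear_map k q p \<Phi>" and "positive_map k q p \<Phi>" and "unital_map k q p \<Phi>"
  shows "(matrix_convex_on {0..} f \<and> sub_multiplicative_on {0..} f \<and> sign_condition k f \<longrightarrow>
            loewner_le p (mat_fun f (\<Phi> As)) (\<Phi> (map (mat_fun f) As))) \<and>
         (matrix_concave_on {0..} f \<and> super_multiplicative_on {0..} f \<longrightarrow>
            loewner_le p (\<Phi> (map (mat_fun f) As)) (mat_fun f (\<Phi> As)))"
proof -
  obtain N W xs where W: "W \<in> carrier_mat p N" "W * mat_adjoint W = 1\<^sub>m p"
    and len: "\<And>r. r < N \<Longrightarrow> length (xs r) = k"
    and nn: "\<And>r x. r < N \<Longrightarrow> x \<in> set (xs r) \<Longrightarrow> 0 \<le> x"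
    and rep: "\<And>g. \<Phi> (map (mat_fun g) As) =
       W * mat_diag N (\<lambda>r. complex_of_real (prod_list (map g (xs r)))) * mat_adjoint W"
    using unital_multilinear_compression[OF assms(6-8,4,5)] by metis
  define x where "x r = prod_list (xs r)" for r
  define S where "S c = W * mat_diag N (\<lambda>r. complex_of_real (c r)) * mat_adjoint W" for c :: "nat \<Rightarrow> real"
  have S_herm: "hermitian_mat p (S c)" for c unfolding S_def by (rule hermitian_sandwich[OF W(1)])
  have S_mono: "Re (quad_form p (S c) v) \<le> Re (quad_form p (S e) v)" if "\<And>r. r < N \<Longrightarrow> c r \<le> e r" for c e v
    unfolding S_def using W(1) that by (rule quad_form_sandwich_mono)
  have x: "0 \<le> x r" if "r < N" for r
    unfolding x_def using nn[OF that] by (intro prod_list_nonneg) auto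
  have ne: "xs r \<noteq> []" if "r < N" for r using len[OF that] assms(1) by auto
  have "map (mat_fun (\<lambda>x. x)) As = As"
    using assms(5) mat_fun_id by (auto simp: positive_mat_def intro!: map_idI)
  then have A: "\<Phi> As = S x"
    using rep[of "\<lambda>x. x"] by (simp add: S_def x_def)
  have fA: "\<Phi> (map (mat_fun f) As) = S (\<lambda>r. prod_list (map f (xs r)))"
    unfolding S_def by (rule rep)
  note le = loewner_le_iff_quad_form[OF hermitian_mat_fun[OF S_herm] S_herm]
    loewner_le_iff_quad_form[OF S_herm hermitian_mat_fun[OF S_herm]]
  show ?thesis
    unfolding A fA
  proof (intro conjI impI; elim conjE)
    assume f: "matrix_convex_on {0..} f" "sub_multiplicative_on {0..} f" "sign_condition k f"
    show "loewner_le p (mat_fun f (S x)) (S (\<lambda>r. prod_list (map f (xs r))))"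
      unfolding le
    proof
      fix v
      have "loewner_le p (mat_fun f (S x)) (S (\<lambda>r. f (x r)))"
        unfolding S_def by (rule matrix_convex_jensen[OF f(1) W x])
      then have "Re (quad_form p (mat_fun f (S x)) v) \<le> Re (quad_form p (S (\<lambda>r. f (x r))) v)"
        unfolding le by blast
      also have "\<dots> \<le> Re (quad_form p (S (\<lambda>r. prod_list (map f (xs r)))) v)"
      proof (rule S_mono)
        fix r assume r: "r < N"
        show "f (x r) \<le> prod_list (map f (xs r))"
          unfolding x_def using f len[OF r] nn[OF r] ne[OF r]
          by (intro submultiplicative_prod_list) auto
      qed
      finally show "Re (quad_form p (mat_fun f (S x)) v) \<le>
        Re (quad_form p (S (\<lambda>r. prod_list (map f (xs r)))) v)" .
    qed
  next
    assume f: "matrix_concave_on {0..} f" "super_multiplicative_on {0..} f"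
    show "loewner_le p (S (\<lambda>r. prod_list (map f (xs r)))) (mat_fun f (S x))"
      unfolding le
    proof
      fix v
      have "Re (quad_form p (S (\<lambda>r. prod_list (map f (xs r)))) v) \<le> Re (quad_form p (S (\<lambda>r. f (x r))) v)"
      proof (rule S_mono)
        fix r assume r: "r < N"
        show "prod_list (map f (xs r)) \<le> f (x r)"
          unfolding x_def using f(2) nn[OF r] ne[OF r]
          by (intro supermultiplicative_prod_list) auto
      qed
      moreover have "loewner_le p (mat_fun (\<lambda>x. - f x) (S x)) (S (\<lambda>r. - f (x r)))"
        using f(1) unfolding S_def matrix_concave_on_def by (rule matrix_convex_jensen[OF _ W x])
      then have "Re (quad_form p (mat_fun (\<lambda>x. - f x) (S x)) v) \<le> Re (quad_form p (S (\<lambda>r. - f (x r))) v)"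
        unfolding le by blast
      moreover have "quad_form p (S (\<lambda>r. - f (x r))) v = - quad_form p (S (\<lambda>r. f (x r))) v"
        by (simp add: S_def quad_form_sandwich[OF W(1)] sum_negf)
      ultimately show "Re (quad_form p (S (\<lambda>r. prod_list (map f (xs r)))) v) \<le>
        Re (quad_form p (mat_fun f (S x)) v)"
        by (simp add: quad_form_mat_fun_uminus[OF S_herm])
    qed
  qed
qed

end
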